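(* Let $G=(V,E)$ be an infinite, connected, locally finite graph. If \[ p_c^{\mathrm{site}}(G)<p<p_{\mathrm{conn}}(G), \] then Bernoulli$(p)$ site percolation on $G$ has almost surely infinitely many infinite open clusters.
   Context: In Bernoulli$(p)$ site percolation with law $\mathbb{P}_p$ each vertex is independently open with probability $p$ and closed otherwise; open clusters are the connected components of the subgraph induced by open vertices; $x\leftrightarrow y$ is the event that $x$ and $y$ are in the same open cluster. The critical value is $p_c^{\mathrm{site}}(G)=\inf\{p\in[0,1]:\mathbb{P}_p(G\text{ has an infinite open cluster})=1\}$. With $d_G$ the graph distance, \[ p_{\mathrm{conn}}(G):=\sup\Bigl\{p\in(0,1):\ \lim_{n\to\infty}\ \sup_{x,y\in V,\ d_G(x,y)\ge n}\mathbb{P}_p(x\leftrightarrow y)=0\Bigr\}. \] *)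

theory Defs
  imports "HOL-Probability.Probability" "Graph_Theory.Graph_Theory"
begin

text \<open>
  As in the library, an undirected graph is a symmetric digraph: each undirected edge is a pair of
  opposite arcs. The library's \<open>graph\<close> locale also demands finiteness, which is dropped here.
\<close>

locale simple_graph = sym_digraph G + loopfree_digraph G + nomulti_digraph G
  for G :: "('a, 'b) pre_digraph"

text \<open>In a symmetric digraph the out-arcs of a vertex correspond to its incident edges.\<close>

definition locally_finite :: "('a, 'b) pre_digraph \<Rightarrow> bool" where
  "locally_finite G \<longleftrightarrow> (\<forall>v \<in> verts G. finite (out_arcs G v))"

text \<open>\<open>wf_digraph.\<mu>\<close> is the infimum of the costs of the walks between two vertices.\<close>

definition graph_dist :: "('a, 'b) pre_digraph \<Rightarrow> 'a \<Rightarrow> 'a \<Rightarrow> ereal" where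
  "graph_dist G x y = wf_digraph.\<mu> G (\<lambda>_. 1) x y"

text \<open>
  A configuration assigns \<^const>\<open>True\<close> to the open vertices. Outside \<open>p \<in> {0..1}\<close>, where
  \<^const>\<open>bernoulli_pmf\<close> truncates its parameter, the law is not used.
\<close>

definition site_percolation :: "('a, 'b) pre_digraph \<Rightarrow> real \<Rightarrow> ('a \<Rightarrow> bool) measure" where
  "site_percolation G p = (\<Pi>\<^sub>M v \<in> verts G. measure_pmf (bernoulli_pmf p))"

text \<open>
  The strongly connected components of a symmetric digraph are its connected components;
  \<^const>\<open>pre_digraph.sccs_verts\<close> gives their vertex sets.
\<close>

definition open_clusters :: "('a, 'b) pre_digraph \<Rightarrow> ('a \<Rightarrow> bool) \<Rightarrow> 'a set set" where
  "open_clusters G \<omega> = pre_digraph.sccs_verts (G \<restriction> {v \<in> verts G. \<omega> v})"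

definition infinite_open_clusters ::
    "('a, 'b) pre_digraph \<Rightarrow> ('a \<Rightarrow> bool) \<Rightarrow> 'a set set" where
  "infinite_open_clusters G \<omega> = {C \<in> open_clusters G \<omega>. infinite C}"

definition same_open_cluster ::
    "('a, 'b) pre_digraph \<Rightarrow> ('a \<Rightarrow> bool) \<Rightarrow> 'a \<Rightarrow> 'a \<Rightarrow> bool" where
  "same_open_cluster G \<omega> x y \<longleftrightarrow> (\<exists>C \<in> open_clusters G \<omega>. x \<in> C \<and> y \<in> C)"

definition connection_prob :: "('a, 'b) pre_digraph \<Rightarrow> real \<Rightarrow> 'a \<Rightarrow> 'a \<Rightarrow> ennreal" where
  "connection_prob G p x y =
     emeasure (site_percolation G p)
       {\<omega> \<in> space (site_percolation G p). same_open_cluster G \<omega> x y}"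

text \<open>
  Both thresholds are taken in \<^typ>\<open>ereal\<close>. For a locally finite graph of unbounded degree no
  parameter need qualify for \<open>p_conn\<close>; the supremum of the empty set is then \<open>-\<infinity>\<close>, whereas in
  \<^typ>\<open>real\<close> it would be an unspecified number.
\<close>

definition p_c_site :: "('a, 'b) pre_digraph \<Rightarrow> ereal" where
  "p_c_site G = Inf (ereal ` {p \<in> {0..1}.
     emeasure (site_percolation G p)
       {\<omega> \<in> space (site_percolation G p). infinite_open_clusters G \<omega> \<noteq> {}} = 1})"

definition p_conn :: "('a, 'b) pre_digraph \<Rightarrow> ereal" where
  "p_conn G = Sup (ereal ` {p \<in> {0<..<1}.
     (\<lambda>n. SUP (x, y) \<in> {(x, y). x \<in> verts G \<and> y \<in> verts G \<and> ereal (real n) \<le> graph_dist G x y}.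
        connection_prob G p x y) \<longlonglongrightarrow> 0})"

end

theory Submission
  imports Defs
begin

text \<open>
  Write \<open>\<theta> p v\<close> for the probability that \<open>v\<close> lies in an infinite open cluster. The theorem is the
  tension between two facts.

  First, above the critical value \<open>\<theta> p\<close> does not vanish at infinity: if an infinite cluster
  exists almost surely at \<open>p' < p\<close> and \<open>0 \<le> c < p - p'\<close>, then outside any given
  finite set there is a vertex \<open>v\<close> with \<open>\<theta> p v > c\<close> (\<open>supercritical_\<theta>_far_away\<close>).
  The reason is a comparison: conditioning \<open>p\<close>-percolation on the cluster of \<open>x\<close> being finite costs little when \<open>\<theta> p\<close> is small. Explore that
  cluster one vertex at a time. By positive association, opening the next vertex \<open>v\<close> lowers the
  conditional probability of finiteness at most by the factor \<open>1 - \<theta> p v / p\<close>, so \<open>v\<close> is still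
  open with conditional probability at least \<open>p - \<theta> p v\<close>. If \<open>\<theta> p \<le> p - p'\<close> everywhere, the
  finite cluster under \<open>p\<close> therefore dominates the unconditioned cluster under \<open>p'\<close>
  (\<open>finite_cluster_dominates\<close>), and the latter must be finite too. Finitely many exceptional
  vertices do no harm, since they can be declared closed in advance: deleting finitely many vertices
  from an infinite cluster leaves an infinite cluster.

  Secondly, below \<open>p_conn\<close> the probability that \<open>y\<close> is connected to a fixed vertex tends to \<open>0\<close> as \<open>y\<close>
  goes to infinity. If with positive probability there were only finitely many infinite clusters, then
  this would be almost sure, because having infinitely many infinite clusters is insensitive to
  finite changes of the configuration (\<open>zero_one_law\<close>). So some finite set \<open>B\<close> would meet all infinite
  clusters with probability more than \<open>1 - c/2\<close>, and a vertex \<open>v\<close> with \<open>\<theta> p v > c\<close> would be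
  connected to \<open>B\<close> with probability more than \<open>c/2\<close>. That is impossible for \<open>v\<close> far away.

  Probabilities are handled throughout through one identity, conditioning on the state of a single
  vertex (\<open>Pr_condition_site\<close>); it drives the inductions for monotonicity in \<open>p\<close>, for
  positive association, for the zero-one law and for the exploration.
\<close>

section \<open>Clusters as sets\<close>

text \<open>
  Working with the vertex set \<open>S\<close> of open sites instead of an induced subgraph makes it easy to
  open and close sites. The rules extend paths at their far end, which is the form of all path
  arguments below; the cluster of a closed site is empty.
\<close>

inductive_set cluster :: "('a \<times> 'a) set \<Rightarrow> 'a set \<Rightarrow> 'a \<Rightarrow> 'a set"
  for E :: "('a \<times> 'a) set" and S :: "'a set" and x :: 'a
where
  cluster_self: "x \<in> S \<Longrightarrow> x \<in> cluster E S x"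
| cluster_step: "y \<in> cluster E S x \<Longrightarrow> (y, z) \<in> E \<Longrightarrow> z \<in> S \<Longrightarrow> z \<in> cluster E S x"

lemma cluster_subset: "cluster E S x \<subseteq> S"
  by (auto elim: cluster.cases)

lemma cluster_mono:
  assumes "S \<subseteq> T"
  shows "cluster E S x \<subseteq> cluster E T x"
proof
  fix y assume "y \<in> cluster E S x"
  then show "y \<in> cluster E T x"
    by induction (use assms in \<open>auto intro: cluster.intros\<close>)
qed

lemma cluster_nonempty_iff: "cluster E S x \<noteq> {} \<longleftrightarrow> x \<in> S"
proof
  assume "cluster E S x \<noteq> {}"
  then obtain y where "y \<in> cluster E S x" by blast
  then show "x \<in> S" by induction
qed (auto intro: cluster_self)

lemma cluster_trans:
  assumes "y \<in> cluster E S x" "z \<in> cluster E S y"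
  shows "z \<in> cluster E S x"
  using assms(2) by induction (use assms(1) in \<open>auto intro: cluster.intros\<close>)

lemma cluster_converse_step:
  assumes "x \<in> S" "(x, y) \<in> E" "z \<in> cluster E S y"
  shows "z \<in> cluster E S x"
proof -
  have "y \<in> S"
    using assms(3) cluster_nonempty_iff by fastforce
  then have "y \<in> cluster E S x"
    using assms by (auto intro: cluster.intros)
  then show ?thesis using assms(3) by (rule cluster_trans)
qed

lemma cluster_sym:
  assumes "sym E" "y \<in> cluster E S x"
  shows "x \<in> cluster E S y"
  using assms(2)
proof induction
  case (cluster_step y z)
  then have "(z, y) \<in> E" using assms(1) by (auto dest: symD)
  then show ?case using cluster_step by (auto intro: cluster_converse_step)
qed (auto intro: cluster_self)

lemma cluster_eq:
  assumes "sym E" "y \<in> cluster E S x"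
  shows "cluster E S y = cluster E S x"
  using assms cluster_sym cluster_trans by fast

text \<open>
  A connection uses only the sites of one path. This is what makes connection events limits of
  events that depend on finitely many sites.
\<close>

lemma cluster_finite_support:
  assumes "y \<in> cluster E S x"
  shows "\<exists>F. finite F \<and> F \<subseteq> S \<and> y \<in> cluster E F x"
  using assms
proof induction
  case cluster_self
  then show ?case by (intro exI[of _ "{x}"]) (auto intro: cluster.intros)
next
  case (cluster_step y z)
  then obtain F where "finite F" "F \<subseteq> S" "y \<in> cluster E F x" by blast
  moreover have "y \<in> cluster E (insert z F) x"
    using \<open>y \<in> cluster E F x\<close> cluster_mono[of F "insert z F"] by blast
  ultimately show ?case
    using cluster_step.hyps by (intro exI[of _ "insert z F"]) (auto intro: cluster.intros)
qed

text \<open>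
  Changing the states in \<open>F\<close> is not felt by a cluster that neither meets \<open>F\<close> nor is adjacent to it.
\<close>

lemma cluster_away:
  assumes "S - F = T - F" "cluster E S x \<inter> (F \<union> E `` F) = {}" "sym E" "x \<in> S"
  shows "cluster E T x = cluster E S x"
proof
  have x: "x \<notin> F" using assms(2,4) cluster_self[of x S E] by blast
  show "cluster E T x \<subseteq> cluster E S x"
  proof
    fix y assume "y \<in> cluster E T x"
    then show "y \<in> cluster E S x"
    proof induction
      case cluster_self
      show ?case using assms(4) by (rule cluster.cluster_self)
    next
      case (cluster_step y z)
      have "z \<notin> F"
        using assms(2,3) cluster_step by (auto dest: symD)
      then have "z \<in> S" using assms(1) cluster_step.hyps by blast
      then show ?case using cluster_step by (auto intro: cluster.intros)
    qed
  qed
  show "cluster E S x \<subseteq> cluster E T x"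
  proof
    fix y assume "y \<in> cluster E S x"
    then show "y \<in> cluster E T x"
    proof induction
      case cluster_self
      show ?case using assms x cluster_self by (intro cluster.cluster_self) blast
    next
      case (cluster_step y z)
      then have "z \<in> cluster E S x" by (auto intro: cluster.intros)
      then have "z \<notin> F" using assms(2) by blast
      then have "z \<in> T" using assms(1) cluster_step.hyps by blast
      then show ?case using cluster_step by (auto intro: cluster.intros)
    qed
  qed
qed

text \<open>
  Each site of the cluster outside \<open>F\<close> can be reached, after the last visit of its path to \<open>F\<close>, from
  \<open>x\<close> or from one of the finitely many neighbours of \<open>F\<close>. Finitely many pieces cover the
  infinite cluster up to a finite set, so one of them is infinite.
\<close>

lemma infinite_cluster_outside_finite:
  assumes inf: "infinite (cluster E S x)" and F: "finite F"
    and lf: "\<And>v. v \<in> F \<Longrightarrow> finite (E `` {v})"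
  shows "\<exists>y\<in>S - F. infinite (cluster E (S - F) y)"
proof -
  define Y where "Y = (insert x (E `` F) \<inter> S) - F"
  have cover: "z \<in> F \<or> (\<exists>y\<in>Y. z \<in> cluster E (S - F) y)" if "z \<in> cluster E S x" for z
    using that
  proof induction
    case cluster_self
    then show ?case unfolding Y_def by (auto intro: cluster.intros)
  next
    case (cluster_step y z)
    show ?case
    proof (cases "z \<in> F")
      case False
      show ?thesis
      proof (cases "y \<in> F")
        case True
        then have "z \<in> Y" "z \<in> cluster E (S - F) z"
          using cluster_step False unfolding Y_def by (auto intro: cluster.intros)
        then show ?thesis by blast
      next
        case y: False
        then obtain w where "w \<in> Y" "y \<in> cluster E (S - F) w" using cluster_step by blast
        then show ?thesis
          using cluster_step.hyps False by (auto intro: cluster.intros)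
      qed
    qed auto
  qed
  have "E `` F = (\<Union>v\<in>F. E `` {v})" by blast
  then have "finite Y" using F lf unfolding Y_def by auto
  have "cluster E S x \<subseteq> F \<union> (\<Union>y\<in>Y. cluster E (S - F) y)" using cover by blast
  then have "infinite (\<Union>y\<in>Y. cluster E (S - F) y)"
    using inf F by (meson finite_UnI finite_subset)
  then obtain y where "y \<in> Y" "infinite (cluster E (S - F) y)"
    using \<open>finite Y\<close> by blast
  then show ?thesis unfolding Y_def by blast
qed

text \<open>
  Follow a path from \<open>x\<close>. After its last visit to \<open>v\<close> it either comes back to the connected set \<open>R\<close>
  around \<open>x\<close>, and then its end is reached without \<open>v\<close>, or it avoids \<open>R\<close> from then on and
  runs inside \<open>S\<close>. In the exploration \<open>R\<close> is the part revealed as open and \<open>S\<close> the original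
  configuration, so the part behind \<open>v\<close> is bounded by an unconditioned cluster.
\<close>

lemma cluster_insert_subset:
  assumes "x \<in> R" "R \<subseteq> cluster E R x" "R \<subseteq> T" "T - R \<subseteq> S" "v \<notin> R"
  shows "cluster E (insert v T) x \<subseteq> cluster E (T - {v}) x \<union> cluster E (insert v S) v"
proof
  have R: "R \<subseteq> cluster E (T - {v}) x"
    using assms cluster_mono[of R "T - {v}" E x] by blast
  fix z assume "z \<in> cluster E (insert v T) x"
  then show "z \<in> cluster E (T - {v}) x \<union> cluster E (insert v S) v"
  proof induction
    case cluster_self
    then show ?case using assms(1) R by blast
  next
    case (cluster_step y z)
    consider "z = v" | "z \<in> R" | "z \<noteq> v" "z \<notin> R" "z \<in> T" "z \<in> S"
      using cluster_step.hyps assms(4) by blast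
    then show ?case
    proof cases
      case 1
      then show ?thesis by (auto intro: cluster.intros)
    next
      case 2
      then show ?thesis using R by blast
    next
      case 3
      then show ?thesis using cluster_step by (auto intro: cluster.intros)
    qed
  qed
qed

section \<open>Bernoulli site configurations\<close>

text \<open>
  Events are predicates on the set of open sites. Configurations are functions with the value
  \<^const>\<open>undefined\<close> off \<open>V\<close>; passing to the set \<open>opens\<close> removes that artefact.
\<close>

locale bernoulli_sites =
  fixes V :: "'a set"
  assumes countable_sites: "countable V"
begin

definition law :: "real \<Rightarrow> ('a \<Rightarrow> bool) measure" where
  "law p = (\<Pi>\<^sub>M v\<in>V. measure_pmf (bernoulli_pmf p))"

definition opens :: "('a \<Rightarrow> bool) \<Rightarrow> 'a set" where
  "opens \<omega> = {v \<in> V. \<omega> v}"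

text \<open>
  The product of the counting spaces has the same measurable sets as \<open>law p\<close>, for every \<open>p\<close>, so one
  notion of event serves all parameters.
\<close>

definition event :: "('a set \<Rightarrow> bool) \<Rightarrow> bool" where
  "event Q \<longleftrightarrow> Measurable.pred (\<Pi>\<^sub>M v\<in>V. count_space UNIV) (\<lambda>\<omega>. Q (opens \<omega>))"

definition Pr :: "real \<Rightarrow> ('a set \<Rightarrow> bool) \<Rightarrow> real" where
  "Pr p Q = measure (law p) {\<omega> \<in> space (law p). Q (opens \<omega>)}"

lemma prob_space_law: "prob_space (law p)"
  unfolding law_def by (intro prob_space_PiM measure_pmf.prob_space_axioms)

sublocale law: prob_space "law p" for p
  by (rule prob_space_law)

lemma sets_law: "sets (law p) = sets (\<Pi>\<^sub>M v\<in>V. count_space UNIV)"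
  unfolding law_def by (intro sets_PiM_cong) auto

lemma space_law: "space (law p) = space (\<Pi>\<^sub>M v\<in>V. count_space UNIV)"
  using sets_law by (rule sets_eq_imp_space_eq)

lemma event_iff: "event Q \<longleftrightarrow> {\<omega> \<in> space (law p). Q (opens \<omega>)} \<in> sets (law p)"
  unfolding event_def space_law sets_law by (simp add: pred_def)

lemma event_sets: "event Q \<Longrightarrow> {\<omega> \<in> space (law p). Q (opens \<omega>)} \<in> sets (law p)"
  unfolding event_iff[of Q p] .

lemma opens_subset: "opens \<omega> \<subseteq> V"
  by (auto simp: opens_def)

lemma event_cong:
  assumes "\<And>S. S \<subseteq> V \<Longrightarrow> A S = B S"
  shows "event A \<longleftrightarrow> event B"
  unfolding event_def using assms opens_subset by simp

lemma event_site: "v \<in> V \<Longrightarrow> event (\<lambda>S. v \<in> S)"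
  unfolding event_def opens_def by simp

lemma event_Not: "event A \<Longrightarrow> event (\<lambda>S. \<not> A S)"
  unfolding event_def by simp

lemma event_conj: "event A \<Longrightarrow> event B \<Longrightarrow> event (\<lambda>S. A S \<and> B S)"
  unfolding event_def by simp

lemma event_Ball:
  assumes "countable I" "\<And>i. i \<in> I \<Longrightarrow> event (A i)"
  shows "event (\<lambda>S. \<forall>i\<in>I. A i S)"
  using assms unfolding event_iff[of _ 0] by (auto intro!: sets.sets_Collect_countable_Ball)

lemma event_Bex:
  assumes "countable I" "\<And>i. i \<in> I \<Longrightarrow> event (A i)"
  shows "event (\<lambda>S. \<exists>i\<in>I. A i S)"
  using assms unfolding event_iff[of _ 0] by (auto intro!: sets.sets_Collect_countable_Bex)

lemma opens_upd:
  assumes "v \<in> V"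
  shows "opens (fun_upd \<omega> v True) = insert v (opens \<omega>)" "opens (fun_upd \<omega> v False) = opens \<omega> - {v}"
  using assms by (auto simp: opens_def)

lemma Pr_cong:
  assumes "\<And>S. S \<subseteq> V \<Longrightarrow> A S = B S"
  shows "Pr p A = Pr p B"
  unfolding Pr_def using assms opens_subset by simp

lemma Pr_mono:
  assumes "event B" "\<And>S. S \<subseteq> V \<Longrightarrow> A S \<Longrightarrow> B S"
  shows "Pr p A \<le> Pr p B"
  unfolding Pr_def
  using assms opens_subset by (intro law.finite_measure_mono) (auto intro: event_sets)

lemma Pr_nonneg: "0 \<le> Pr p A"
  by (simp add: Pr_def)

lemma Pr_le_1: "Pr p A \<le> 1"
  by (simp add: Pr_def)

lemma Pr_const: "Pr p (\<lambda>_. c) = (if c then 1 else 0)"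
  by (simp add: Pr_def law.prob_space)

lemma Pr_Not:
  assumes "event A"
  shows "Pr p (\<lambda>S. \<not> A S) = 1 - Pr p A"
  unfolding Pr_def using assms by (intro law.prob_neg event_sets)

lemma Pr_split:
  assumes "event A" "event B"
  shows "Pr p A = Pr p (\<lambda>S. A S \<and> B S) + Pr p (\<lambda>S. A S \<and> \<not> B S)"
proof -
  let ?X = "\<lambda>Q. {\<omega> \<in> space (law p). Q (opens \<omega>)}"
  have "measure (law p) (?X (\<lambda>S. A S \<and> B S) \<union> ?X (\<lambda>S. A S \<and> \<not> B S)) =
      Pr p (\<lambda>S. A S \<and> B S) + Pr p (\<lambda>S. A S \<and> \<not> B S)"
    unfolding Pr_def using assms event_conj event_Not
    by (intro law.finite_measure_Union event_sets) auto
  moreover have "?X (\<lambda>S. A S \<and> B S) \<union> ?X (\<lambda>S. A S \<and> \<not> B S) = ?X A"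
    by auto
  ultimately show ?thesis by (simp add: Pr_def)
qed

lemma Pr_Bex_le:
  assumes "finite I" "\<And>i. i \<in> I \<Longrightarrow> event (A i)"
  shows "Pr p (\<lambda>S. \<exists>i\<in>I. A i S) \<le> (\<Sum>i\<in>I. Pr p (A i))"
proof -
  have "{\<omega> \<in> space (law p). \<exists>i\<in>I. A i (opens \<omega>)} = (\<Union>i\<in>I. {\<omega> \<in> space (law p). A i (opens \<omega>)})"
    by auto
  then show ?thesis
    unfolding Pr_def using assms
    by (auto intro!: law.finite_measure_subadditive_finite event_sets)
qed

lemma Pr_incseq:
  assumes "\<And>n. event (A n)" "\<And>n S. S \<subseteq> V \<Longrightarrow> A n S \<Longrightarrow> A (Suc n) S"
  shows "(\<lambda>n. Pr p (A n)) \<longlonglongrightarrow> Pr p (\<lambda>S. \<exists>n. A n S)"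
proof -
  let ?X = "\<lambda>n. {\<omega> \<in> space (law p). A n (opens \<omega>)}"
  have "(\<lambda>n. measure (law p) (?X n)) \<longlonglongrightarrow> measure (law p) (\<Union>n. ?X n)"
  proof (rule law.finite_Lim_measure_incseq)
    show "range ?X \<subseteq> sets (law p)"
      using event_sets[OF assms(1)] by blast
    show "incseq ?X"
      using assms(2)[OF opens_subset] by (intro incseq_SucI) blast
  qed
  moreover have "(\<Union>n. ?X n) = {\<omega> \<in> space (law p). \<exists>n. A n (opens \<omega>)}" by auto
  ultimately show ?thesis by (simp add: Pr_def)
qed

lemma Pr_decseq:
  assumes "\<And>n. event (A n)" "\<And>n S. S \<subseteq> V \<Longrightarrow> A (Suc n) S \<Longrightarrow> A n S"
  shows "(\<lambda>n. Pr p (A n)) \<longlonglongrightarrow> Pr p (\<lambda>S. \<forall>n. A n S)"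
proof -
  let ?X = "\<lambda>n. {\<omega> \<in> space (law p). A n (opens \<omega>)}"
  have "(\<lambda>n. measure (law p) (?X n)) \<longlonglongrightarrow> measure (law p) (\<Inter>n. ?X n)"
  proof (rule law.finite_Lim_measure_decseq)
    show "range ?X \<subseteq> sets (law p)"
      using event_sets[OF assms(1)] by blast
    show "decseq ?X"
      using assms(2)[OF opens_subset] by (intro decseq_SucI) blast
  qed
  moreover have "(\<Inter>n. ?X n) = {\<omega> \<in> space (law p). \<forall>n. A n (opens \<omega>)}" by auto
  ultimately show ?thesis by (simp add: Pr_def)
qed

text \<open>
  Resampling the state of \<open>v\<close> independently of everything else leaves the law invariant.
\<close>

lemma Pr_condition_site:
  assumes "v \<in> V" "event Q" "p \<in> {0..1}"
  shows "Pr p Q = p * Pr p (\<lambda>S. Q (insert v S)) + (1 - p) * Pr p (\<lambda>S. Q (S - {v}))"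
proof -
  let ?B = "measure_pmf (bernoulli_pmf p)"
  let ?X = "\<lambda>Q. {\<omega> \<in> space (law p). Q (opens \<omega>)}"
  let ?f = "\<lambda>(b, \<omega>). fun_upd \<omega> v b"
  have law_eq: "distr (?B \<Otimes>\<^sub>M law p) (law p) ?f = law p"
    using distr_pair_PiM_eq_PiM[of V "\<lambda>_. ?B" v] assms(1)
    by (simp add: law_def insert_absorb measure_pmf.prob_space_axioms)
  have f[measurable]: "?f \<in> measurable (?B \<Otimes>\<^sub>M law p) (law p)"
  proof -
    have "(\<lambda>z. (\<lambda>(f, y). fun_upd f v y) (snd z, fst z)) \<in>
        measurable (?B \<Otimes>\<^sub>M law p) (\<Pi>\<^sub>M v\<in>insert v V. ?B)"
      unfolding law_def
      by (intro measurable_compose[OF _ measurable_add_dim] measurable_Pair measurable_fst measurable_snd)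
    then show ?thesis
      using assms(1) by (simp add: law_def insert_absorb case_prod_unfold)
  qed
  have QX: "?X Q \<in> sets (law p)" using assms(2) by (rule event_sets)
  have slice: "Pair b -` (?f -` ?X Q \<inter> space (?B \<Otimes>\<^sub>M law p)) = ?X (\<lambda>S. Q (if b then insert v S else S - {v}))"
    for b
  proof -
    have "fun_upd \<omega> v b \<in> space (law p)" if "\<omega> \<in> space (law p)" for \<omega>
      using that assms(1) by (auto simp: law_def space_PiM PiE_def extensional_def)
    then show ?thesis
      using opens_upd[OF assms(1)] by (cases b) (auto simp: space_pair_measure)
  qed
  have "emeasure (law p) (?X Q) = emeasure (?B \<Otimes>\<^sub>M law p) (?f -` ?X Q \<inter> space (?B \<Otimes>\<^sub>M law p))"
    using emeasure_distr[OF f QX] law_eq by simp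
  also have "\<dots> = (\<integral>\<^sup>+b. emeasure (law p) (?X (\<lambda>S. Q (if b then insert v S else S - {v}))) \<partial>?B)"
    by (simp only: law.emeasure_pair_measure_alt[OF measurable_sets[OF f QX]] slice)
  also have "\<dots> = emeasure (law p) (?X (\<lambda>S. Q (insert v S))) * p
      + emeasure (law p) (?X (\<lambda>S. Q (S - {v}))) * (1 - p)"
    using assms(3) by simp
  finally have "ennreal (Pr p Q) =
      ennreal (Pr p (\<lambda>S. Q (insert v S))) * p + ennreal (Pr p (\<lambda>S. Q (S - {v}))) * (1 - p)"
    unfolding law.emeasure_eq_measure Pr_def .
  also have "\<dots> = ennreal (p * Pr p (\<lambda>S. Q (insert v S)) + (1 - p) * Pr p (\<lambda>S. Q (S - {v})))"
    using assms(3) Pr_nonneg by (simp add: ennreal_mult' ennreal_plus mult.commute)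
  finally show ?thesis
    using assms(3) by (subst (asm) ennreal_inj) (auto intro!: add_nonneg_nonneg mult_nonneg_nonneg Pr_nonneg)
qed

section \<open>Cylinder events, positive association and the zero-one law\<close>

definition determined_by :: "'a set \<Rightarrow> ('a set \<Rightarrow> bool) \<Rightarrow> bool" where
  "determined_by F Q \<longleftrightarrow> (\<forall>S. Q S = Q (S \<inter> F))"

lemma determined_by_insert:
  assumes "determined_by (insert v F) Q"
  shows "determined_by F (\<lambda>S. Q (insert v S))" "determined_by F (\<lambda>S. Q (S - {v}))"
proof -
  have Q: "Q S = Q (S \<inter> insert v F)" for S
    using assms unfolding determined_by_def by blast
  have "insert v S \<inter> insert v F = insert v (S \<inter> F) \<inter> insert v F"
    "(S - {v}) \<inter> insert v F = (S \<inter> F - {v}) \<inter> insert v F" for S by auto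
  then show "determined_by F (\<lambda>S. Q (insert v S))" "determined_by F (\<lambda>S. Q (S - {v}))"
    unfolding determined_by_def using Q by metis+
qed

lemma determined_by_conj:
  "determined_by F A \<Longrightarrow> determined_by F B \<Longrightarrow> determined_by F (\<lambda>S. A S \<and> B S)"
  unfolding determined_by_def by blast

lemma event_determined:
  assumes "finite F" "F \<subseteq> V" "determined_by F Q"
  shows "event Q"
proof -
  have "event (\<lambda>S. (v \<in> S) = (v \<in> T))" if "v \<in> F" for v T
  proof (cases "v \<in> T")
    case True
    then show ?thesis using event_site[of v] that assms(2) by auto
  next
    case False
    then show ?thesis using event_Not[OF event_site[of v]] that assms(2) by auto
  qed
  then have "event (\<lambda>S. \<exists>T\<in>{T \<in> Pow F. Q T}. \<forall>v\<in>F. (v \<in> S) = (v \<in> T))"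
    using assms(1) by (intro event_Bex event_Ball) (auto intro: countable_finite)
  moreover have "(\<exists>T\<in>{T \<in> Pow F. Q T}. \<forall>v\<in>F. (v \<in> S) = (v \<in> T)) = Q S" for S
  proof
    assume "\<exists>T\<in>{T \<in> Pow F. Q T}. \<forall>v\<in>F. (v \<in> S) = (v \<in> T)"
    then obtain T where T: "T \<subseteq> F" "Q T" "\<forall>v\<in>F. (v \<in> S) = (v \<in> T)" by blast
    then have "S \<inter> F = T" by blast
    then show "Q S" using T assms(3) unfolding determined_by_def by metis
  next
    assume "Q S"
    then have "Q (S \<inter> F)" using assms(3) unfolding determined_by_def by blast
    then show "\<exists>T\<in>{T \<in> Pow F. Q T}. \<forall>v\<in>F. (v \<in> S) = (v \<in> T)"
      by (intro bexI[of _ "S \<inter> F"]) auto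
  qed
  ultimately show ?thesis by simp
qed

text \<open>
  An exhaustion of \<open>V\<close> by finite sets, along which all limits are taken.
\<close>

definition window :: "nat \<Rightarrow> 'a set" where
  "window n = V \<inter> from_nat_into V ` {..<n}"

lemma window_subset: "window n \<subseteq> V" and finite_window: "finite (window n)"
  by (auto simp: window_def)

lemma window_Suc: "window n \<subseteq> window (Suc n)"
  by (auto simp: window_def)

lemma window_mono: "m \<le> n \<Longrightarrow> window m \<subseteq> window n"
  by (auto simp: window_def)

lemma finite_subset_window:
  assumes "finite F" "F \<subseteq> V"
  shows "\<exists>n. F \<subseteq> window n"
  using assms
proof induction
  case (insert x F)
  then obtain n where n: "F \<subseteq> window n" by blast
  let ?m = "max n (Suc (to_nat_on V x))"
  have "from_nat_into V (to_nat_on V x) = x"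
    using insert.prems countable_sites by simp
  then have "x \<in> window ?m"
    using insert.prems unfolding window_def by (auto intro!: image_eqI[of _ _ "to_nat_on V x"])
  then show ?case using n window_mono[of n ?m] by (intro exI[of _ ?m]) auto
qed simp

text \<open>
  Increasing events with finite witnesses. Restricted to the windows they become events of finitely
  many sites, and they are the increasing limits of these restrictions.
\<close>

definition finitary :: "('a set \<Rightarrow> bool) \<Rightarrow> bool" where
  "finitary Q \<longleftrightarrow> mono Q \<and> (\<forall>S. Q S \<longrightarrow> (\<exists>F. finite F \<and> F \<subseteq> S \<and> Q F))"

lemma finitary_mono: "finitary Q \<Longrightarrow> S \<subseteq> T \<Longrightarrow> Q S \<Longrightarrow> Q T"
  unfolding finitary_def by (blast dest: monoD le_boolD)

lemma finitary_conj:
  assumes "finitary A" "finitary B"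
  shows "finitary (\<lambda>S. A S \<and> B S)"
  unfolding finitary_def
proof (intro conjI allI impI)
  show "mono (\<lambda>S. A S \<and> B S)"
    using finitary_mono[OF assms(1)] finitary_mono[OF assms(2)] by (intro monoI le_boolI) blast
  fix S assume "A S \<and> B S"
  then obtain F H where "finite F" "F \<subseteq> S" "A F" "finite H" "H \<subseteq> S" "B H"
    using assms unfolding finitary_def by blast
  moreover have "A (F \<union> H)" "B (F \<union> H)"
    using finitary_mono[OF assms(1), of F "F \<union> H"] finitary_mono[OF assms(2), of H "F \<union> H"] calculation
    by auto
  ultimately show "\<exists>F. finite F \<and> F \<subseteq> S \<and> A F \<and> B F"
    by (intro exI[of _ "F \<union> H"]) auto
qed

lemma event_finitary:
  assumes "finitary Q"
  shows "event Q"
proof -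
  let ?E = "\<lambda>S. \<exists>F\<in>{F. finite F \<and> F \<subseteq> V \<and> Q F}. \<forall>v\<in>F. v \<in> S"
  have "event ?E"
  proof (intro event_Bex event_Ball event_site)
    show "countable {F. finite F \<and> F \<subseteq> V \<and> Q F}"
      by (rule countable_subset[OF _ countable_Collect_finite_subset[OF countable_sites]]) auto
  qed (auto intro: countable_finite)
  moreover have "event ?E = event Q"
  proof (rule event_cong, rule iffI)
    fix S assume "?E S"
    then obtain F where "Q F" "F \<subseteq> S" by blast
    then show "Q S" using finitary_mono[OF assms] by blast
  next
    fix S assume "S \<subseteq> V" "Q S"
    then obtain F where "finite F" "F \<subseteq> S" "Q F" using assms unfolding finitary_def by blast
    then show "?E S" using \<open>S \<subseteq> V\<close> by blast
  qed
  ultimately show ?thesis by simp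
qed

lemma finitary_window:
  assumes "finitary Q"
  shows "mono (\<lambda>S. Q (S \<inter> window n))" "determined_by (window n) (\<lambda>S. Q (S \<inter> window n))"
proof -
  show "mono (\<lambda>S. Q (S \<inter> window n))"
    using finitary_mono[OF assms] by (intro monoI le_boolI) (meson Int_mono order_refl)
  show "determined_by (window n) (\<lambda>S. Q (S \<inter> window n))"
    unfolding determined_by_def by (simp add: Int_assoc)
qed

lemma Pr_window_tendsto:
  assumes "finitary Q"
  shows "(\<lambda>n. Pr p (\<lambda>S. Q (S \<inter> window n))) \<longlonglongrightarrow> Pr p Q"
proof -
  have "(\<lambda>n. Pr p (\<lambda>S. Q (S \<inter> window n))) \<longlonglongrightarrow> Pr p (\<lambda>S. \<exists>n. Q (S \<inter> window n))"
  proof (rule Pr_incseq)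
    show "event (\<lambda>S. Q (S \<inter> window n))" for n
      using event_determined[OF finite_window window_subset finitary_window(2)[OF assms]] .
    show "Q (S \<inter> window (Suc n))" if "Q (S \<inter> window n)" for n S
      using finitary_mono[OF assms _ that] window_Suc[of n] by blast
  qed
  moreover have "Pr p (\<lambda>S. \<exists>n. Q (S \<inter> window n)) = Pr p Q"
  proof (rule Pr_cong, rule iffI)
    fix S assume "\<exists>n. Q (S \<inter> window n)"
    then show "Q S" using finitary_mono[OF assms] by blast
  next
    fix S assume "S \<subseteq> V" "Q S"
    then obtain F where F: "finite F" "F \<subseteq> S" "Q F" using assms unfolding finitary_def by blast
    then obtain n where "F \<subseteq> window n" using finite_subset_window \<open>S \<subseteq> V\<close> by blast
    then show "\<exists>n. Q (S \<inter> window n)"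
      using F finitary_mono[OF assms, of F] by (meson Int_greatest)
  qed
  ultimately show ?thesis by simp
qed

lemma mono_insert_delete:
  assumes "mono Q"
  shows "mono (\<lambda>S. Q (insert v S))" "mono (\<lambda>S. Q (S - {v}))" "Q (S - {v}) \<Longrightarrow> Q (insert v S)"
proof -
  show "mono (\<lambda>S. Q (insert v S))" "mono (\<lambda>S. Q (S - {v}))"
    by (intro monoI monoD[OF assms]; blast)+
  show "Q (S - {v}) \<Longrightarrow> Q (insert v S)"
    using monoD[OF assms, of "S - {v}" "insert v S"] by (auto simp: le_bool_def)
qed

text \<open>
  On finitely many sites, condition on one site at a time: opening it favours the event, so raising
  the weight of the open case raises the probability.
\<close>

lemma Pr_mono_param:
  assumes "finitary Q" "0 \<le> p" "p \<le> q" "q \<le> 1"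
  shows "Pr p Q \<le> Pr q Q"
proof -
  have cyl: "Pr p A \<le> Pr q A" if "finite F" "F \<subseteq> V" "mono A" "determined_by F A" for F A
    using that
  proof (induction F arbitrary: A)
    case empty
    have "Pr r A = Pr r (\<lambda>_. A {})" for r
      by (rule Pr_cong) (use empty in \<open>simp add: determined_by_def\<close>)
    then show ?case by (simp add: Pr_const)
  next
    case (insert v F)
    let ?A1 = "\<lambda>S. A (insert v S)" and ?A0 = "\<lambda>S. A (S - {v})"
    note det = determined_by_insert[OF insert.prems(3)]
    have v: "v \<in> V" and F: "F \<subseteq> V" using insert.prems by auto
    have ev: "event A" "event ?A1"
      using event_determined[OF _ insert.prems(1,3)] event_determined[OF _ F det(1)] insert.hyps by auto
    have IH: "Pr p ?A1 \<le> Pr q ?A1" "Pr p ?A0 \<le> Pr q ?A0"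
      by (rule insert.IH[OF F mono_insert_delete(1)[OF insert.prems(2)] det(1)],
          rule insert.IH[OF F mono_insert_delete(2)[OF insert.prems(2)] det(2)])
    have le: "Pr q ?A0 \<le> Pr q ?A1"
      by (rule Pr_mono[OF ev(2)]) (rule mono_insert_delete(3)[OF insert.prems(2)])
    have "Pr p A = p * Pr p ?A1 + (1 - p) * Pr p ?A0"
      using Pr_condition_site[OF v ev(1)] assms by simp
    also have "\<dots> \<le> p * Pr q ?A1 + (1 - p) * Pr q ?A0"
      using IH assms by (intro add_mono mult_left_mono) auto
    also have "\<dots> \<le> q * Pr q ?A1 + (1 - q) * Pr q ?A0"
    proof -
      have "0 \<le> (q - p) * (Pr q ?A1 - Pr q ?A0)"
        using le assms by (intro mult_nonneg_nonneg) auto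
      then show ?thesis by (simp add: algebra_simps)
    qed
    also have "\<dots> = Pr q A"
      using Pr_condition_site[OF v ev(1)] assms by simp
    finally show ?case .
  qed
  show ?thesis
    using cyl[OF finite_window window_subset finitary_window[OF assms(1)]]
    by (intro LIMSEQ_le[OF Pr_window_tendsto[OF assms(1)] Pr_window_tendsto[OF assms(1)]]) auto
qed

text \<open>
  Given the state of one site the inequality holds by induction, and two increasing functions of
  that single state are positively correlated: the gap is
  \<open>p (1 - p) (A\<^sub>1 - A\<^sub>0) (B\<^sub>1 - B\<^sub>0)\<close> in terms of the conditional probabilities.
\<close>

lemma harris_determined:
  assumes "finite F" "F \<subseteq> V" "mono A" "mono B" "determined_by F A" "determined_by F B" "p \<in> {0..1}"
  shows "Pr p A * Pr p B \<le> Pr p (\<lambda>S. A S \<and> B S)"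
  using assms
proof (induction F arbitrary: A B)
  case empty
  have "A S = A {}" "B S = B {}" for S
    using empty.prems(4,5) unfolding determined_by_def by (metis Int_empty_right)+
  then have "Pr p A = Pr p (\<lambda>_. A {})" "Pr p B = Pr p (\<lambda>_. B {})"
    "Pr p (\<lambda>S. A S \<and> B S) = Pr p (\<lambda>_. A {} \<and> B {})"
    by (auto intro!: Pr_cong)
  then show ?case by (simp add: Pr_const)
next
  case (insert v F)
  let ?A1 = "\<lambda>S. A (insert v S)" and ?A0 = "\<lambda>S. A (S - {v})"
  let ?B1 = "\<lambda>S. B (insert v S)" and ?B0 = "\<lambda>S. B (S - {v})"
  have v: "v \<in> V" and F: "F \<subseteq> V" and p: "p \<in> {0..1}" using insert.prems by auto
  have fin: "finite (insert v F)" using insert.hyps by simp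
  note detA = determined_by_insert[OF insert.prems(4)] and detB = determined_by_insert[OF insert.prems(5)]
  note mA = mono_insert_delete[OF insert.prems(2)] and mB = mono_insert_delete[OF insert.prems(3)]
  have IH: "Pr p ?A1 * Pr p ?B1 \<le> Pr p (\<lambda>S. ?A1 S \<and> ?B1 S)"
    "Pr p ?A0 * Pr p ?B0 \<le> Pr p (\<lambda>S. ?A0 S \<and> ?B0 S)"
    using insert.IH[OF F mA(1) mB(1) detA(1) detB(1) p] insert.IH[OF F mA(2) mB(2) detA(2) detB(2) p] .
  have ev: "event A" "event B" "event (\<lambda>S. A S \<and> B S)"
    using event_determined[OF fin insert.prems(1) insert.prems(4)]
      event_determined[OF fin insert.prems(1) insert.prems(5)]
      event_determined[OF fin insert.prems(1) determined_by_conj[OF insert.prems(4,5)]] .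
  have ev1: "event ?A1" "event ?B1"
    using event_determined[OF insert.hyps(1) F detA(1)] event_determined[OF insert.hyps(1) F detB(1)] .
  have le: "Pr p ?A0 \<le> Pr p ?A1" "Pr p ?B0 \<le> Pr p ?B1"
    by (rule Pr_mono[OF ev1(1)], erule mA(3), rule Pr_mono[OF ev1(2)], erule mB(3))
  have "0 \<le> p * (1 - p) * ((Pr p ?A1 - Pr p ?A0) * (Pr p ?B1 - Pr p ?B0))"
    using le p by (intro mult_nonneg_nonneg) auto
  then have "(p * Pr p ?A1 + (1 - p) * Pr p ?A0) * (p * Pr p ?B1 + (1 - p) * Pr p ?B0)
      \<le> p * (Pr p ?A1 * Pr p ?B1) + (1 - p) * (Pr p ?A0 * Pr p ?B0)"
    by (simp add: algebra_simps)
  also have "\<dots> \<le> p * Pr p (\<lambda>S. ?A1 S \<and> ?B1 S) + (1 - p) * Pr p (\<lambda>S. ?A0 S \<and> ?B0 S)"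
    using IH p by (intro add_mono mult_left_mono) auto
  finally show ?case
    using Pr_condition_site[OF v ev(1) p] Pr_condition_site[OF v ev(2) p]
      Pr_condition_site[OF v ev(3) p] by simp
qed

lemma harris_finitary:
  assumes "finitary A" "finitary B" "p \<in> {0..1}"
  shows "Pr p A * Pr p B \<le> Pr p (\<lambda>S. A S \<and> B S)"
proof (rule LIMSEQ_le)
  show "(\<lambda>n. Pr p (\<lambda>S. A (S \<inter> window n)) * Pr p (\<lambda>S. B (S \<inter> window n))) \<longlonglongrightarrow> Pr p A * Pr p B"
    using assms by (intro tendsto_mult Pr_window_tendsto)
  show "(\<lambda>n. Pr p (\<lambda>S. A (S \<inter> window n) \<and> B (S \<inter> window n))) \<longlonglongrightarrow> Pr p (\<lambda>S. A S \<and> B S)"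
    using Pr_window_tendsto[OF finitary_conj[OF assms(1,2)]] .
  show "\<exists>N. \<forall>n\<ge>N. Pr p (\<lambda>S. A (S \<inter> window n)) * Pr p (\<lambda>S. B (S \<inter> window n))
      \<le> Pr p (\<lambda>S. A (S \<inter> window n) \<and> B (S \<inter> window n))"
    by (intro exI allI impI, rule harris_determined[OF finite_window window_subset])
      (rule finitary_window[OF assms(1)] finitary_window[OF assms(2)] assms(3))+
qed

text \<open>
  Having an infinite cluster is not finitary itself, but a decreasing limit of finitary events; this
  form of the inequality covers it.
\<close>

lemma harris:
  assumes "\<And>n. finitary (A n)" "\<And>n. finitary (B n)" "p \<in> {0..1}"
    and "\<And>n S. A (Suc n) S \<Longrightarrow> A n S" "\<And>n S. B (Suc n) S \<Longrightarrow> B n S"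
  shows "Pr p (\<lambda>S. \<forall>n. A n S) * Pr p (\<lambda>S. \<forall>n. B n S) \<le> Pr p (\<lambda>S. (\<forall>n. A n S) \<and> (\<forall>n. B n S))"
proof (rule LIMSEQ_le)
  show "(\<lambda>n. Pr p (A n) * Pr p (B n)) \<longlonglongrightarrow> Pr p (\<lambda>S. \<forall>n. A n S) * Pr p (\<lambda>S. \<forall>n. B n S)"
    by (intro tendsto_mult Pr_decseq event_finitary assms(1,2)) (erule assms(4) assms(5))+
  have "(\<lambda>n. Pr p (\<lambda>S. A n S \<and> B n S)) \<longlonglongrightarrow> Pr p (\<lambda>S. \<forall>n. A n S \<and> B n S)"
  proof (rule Pr_decseq)
    show "event (\<lambda>S. A n S \<and> B n S)" for n
      by (intro event_finitary finitary_conj assms(1,2))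
    show "A n S \<and> B n S" if "A (Suc n) S \<and> B (Suc n) S" for n S
      using that assms(4)[of n S] assms(5)[of n S] by simp
  qed
  then show "(\<lambda>n. Pr p (\<lambda>S. A n S \<and> B n S)) \<longlonglongrightarrow> Pr p (\<lambda>S. (\<forall>n. A n S) \<and> (\<forall>n. B n S))"
    by (simp add: all_conj_distrib)
  show "\<exists>N. \<forall>n\<ge>N. Pr p (A n) * Pr p (B n) \<le> Pr p (\<lambda>S. A n S \<and> B n S)"
    by (intro exI allI impI harris_finitary assms(1,2,3))
qed

lemma Pr_neither:
  assumes "event A" "event B" "Pr p A * Pr p B \<le> Pr p (\<lambda>S. A S \<and> B S)"
  shows "Pr p (\<lambda>S. \<not> A S) * Pr p (\<lambda>S. \<not> B S) \<le> Pr p (\<lambda>S. \<not> A S \<and> \<not> B S)"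
proof -
  have "Pr p (\<lambda>S. \<not> A S) = Pr p (\<lambda>S. \<not> A S \<and> B S) + Pr p (\<lambda>S. \<not> A S \<and> \<not> B S)"
    using Pr_split[OF event_Not[OF assms(1)] assms(2)] .
  moreover have "Pr p B = Pr p (\<lambda>S. A S \<and> B S) + Pr p (\<lambda>S. \<not> A S \<and> B S)"
    using Pr_split[OF assms(2,1)] by (simp add: conj_commute)
  ultimately show ?thesis
    using assms by (simp add: Pr_Not algebra_simps)
qed

text \<open>
  Conditioning on a site changes \<open>Q\<close> only, so the sites on which \<open>Q\<close> depends can be conditioned away
  one by one.
\<close>

lemma finite_change_invariant_indep:
  assumes D: "event D" "\<And>v S. v \<in> V \<Longrightarrow> D (insert v S) = D S" "\<And>v S. v \<in> V \<Longrightarrow> D (S - {v}) = D S"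
    and p: "p \<in> {0..1}"
    and Q: "finite F" "F \<subseteq> V" "determined_by F Q"
  shows "Pr p (\<lambda>S. D S \<and> Q S) = Pr p D * Pr p Q"
  using Q
proof (induction F arbitrary: Q)
  case empty
  have "Q S = Q {}" for S
    using empty.prems(2) unfolding determined_by_def by (metis Int_empty_right)
  then have "Pr p Q = Pr p (\<lambda>_. Q {})" "Pr p (\<lambda>S. D S \<and> Q S) = Pr p (\<lambda>S. D S \<and> Q {})"
    by (auto intro!: Pr_cong)
  then show ?case by (cases "Q {}") (simp_all add: Pr_const)
next
  case (insert v F)
  let ?Q1 = "\<lambda>S. Q (insert v S)" and ?Q0 = "\<lambda>S. Q (S - {v})"
  have v: "v \<in> V" and F: "F \<subseteq> V" using insert.prems by auto
  have ev: "event Q" using event_determined[OF _ insert.prems] insert.hyps by simp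
  have "Pr p (\<lambda>S. D S \<and> Q S) = p * Pr p (\<lambda>S. D S \<and> ?Q1 S) + (1 - p) * Pr p (\<lambda>S. D S \<and> ?Q0 S)"
    using Pr_condition_site[OF v event_conj[OF D(1) ev] p] D(2,3)[OF v] by simp
  also have "\<dots> = Pr p D * (p * Pr p ?Q1 + (1 - p) * Pr p ?Q0)"
    using insert.IH[OF F determined_by_insert(1)[OF insert.prems(2)]]
      insert.IH[OF F determined_by_insert(2)[OF insert.prems(2)]] by (simp add: algebra_simps)
  finally show ?case using Pr_condition_site[OF v ev p] by simp
qed

text \<open>
  The restriction of the law to \<open>D\<close> and the multiple of the law by the probability of \<open>D\<close> agree on
  cylinders, hence everywhere. Evaluated at \<open>D\<close> itself they give \<open>P(D) = P(D)\<^sup>2\<close>.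
\<close>

lemma zero_one_law:
  assumes D: "event D" "\<And>v S. v \<in> V \<Longrightarrow> D (insert v S) = D S" "\<And>v S. v \<in> V \<Longrightarrow> D (S - {v}) = D S"
    and p: "p \<in> {0..1}"
  shows "Pr p D = 0 \<or> Pr p D = 1"
proof -
  let ?B = "\<lambda>_. measure_pmf (bernoulli_pmf p)"
  let ?X = "{\<omega> \<in> space (law p). D (opens \<omega>)}"
  have X: "?X \<in> sets (law p)" using D(1) by (rule event_sets)
  have "density (law p) (indicator ?X) = scale_measure (ennreal (Pr p D)) (law p)"
  proof (rule measure_eqI_PiM_infinite[where I = V and M = ?B])
    show "sets (density (law p) (indicator ?X)) = sets (Pi\<^sub>M V ?B)"
      "sets (scale_measure (ennreal (Pr p D)) (law p)) = sets (Pi\<^sub>M V ?B)"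
      by (simp_all add: law_def)
    show "finite_measure (density (law p) (indicator ?X))"
    proof (rule finite_measureI)
      have "emeasure (density (law p) (indicator ?X)) (space (law p)) = emeasure (law p) (?X \<inter> space (law p))"
        by (rule emeasure_restricted[OF X sets.top])
      then show "emeasure (density (law p) (indicator ?X)) (space (density (law p) (indicator ?X))) \<noteq> \<infinity>"
        by (simp add: law.emeasure_eq_measure)
    qed
    fix A J assume J: "finite J" "J \<subseteq> V" "\<And>i. i \<in> J \<Longrightarrow> A i \<in> sets (?B i)"
    let ?Q = "\<lambda>S. \<forall>j\<in>J. (j \<in> S) \<in> A j"
    let ?Y = "{\<omega> \<in> space (law p). ?Q (opens \<omega>)}"
    have det: "determined_by J ?Q" by (simp add: determined_by_def)
    have Q: "event ?Q" using event_determined[OF J(1,2) det] .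
    have opens_J: "(j \<in> opens \<omega>) = \<omega> j" if "j \<in> J" for j \<omega>
      using that J(2) by (auto simp: opens_def)
    have emb: "prod_emb V ?B J (Pi\<^sub>E J A) = ?Y"
    proof (intro set_eqI iffI)
      fix \<omega> assume "\<omega> \<in> prod_emb V ?B J (Pi\<^sub>E J A)"
      then have "\<omega> \<in> space (law p)" "\<forall>j\<in>J. \<omega> j \<in> A j"
        by (auto simp: prod_emb_def law_def space_PiM PiE_def Pi_def)
      then show "\<omega> \<in> ?Y" using opens_J by simp
    next
      fix \<omega> assume "\<omega> \<in> ?Y"
      then have "\<omega> \<in> space (law p)" "\<forall>j\<in>J. \<omega> j \<in> A j" using opens_J by simp_all
      then show "\<omega> \<in> prod_emb V ?B J (Pi\<^sub>E J A)"
        by (auto simp: prod_emb_def law_def space_PiM PiE_def Pi_def)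
    qed
    have "emeasure (density (law p) (indicator ?X)) ?Y = emeasure (law p) (?X \<inter> ?Y)"
      using X event_sets[OF Q] by (rule emeasure_restricted)
    also have "?X \<inter> ?Y = {\<omega> \<in> space (law p). D (opens \<omega>) \<and> ?Q (opens \<omega>)}" by auto
    also have "emeasure (law p) \<dots> = ennreal (Pr p (\<lambda>S. D S \<and> ?Q S))"
      by (simp add: law.emeasure_eq_measure Pr_def)
    also have "\<dots> = ennreal (Pr p D) * ennreal (Pr p ?Q)"
      using finite_change_invariant_indep[OF D p J(1,2) det] Pr_nonneg by (simp add: ennreal_mult)
    also have "\<dots> = emeasure (scale_measure (ennreal (Pr p D)) (law p)) ?Y"
      by (simp add: law.emeasure_eq_measure Pr_def)
    finally show "emeasure (density (law p) (indicator ?X)) (prod_emb V ?B J (Pi\<^sub>E J A)) =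
        emeasure (scale_measure (ennreal (Pr p D)) (law p)) (prod_emb V ?B J (Pi\<^sub>E J A))"
      unfolding emb .
  qed
  then have "emeasure (law p) (?X \<inter> ?X) = ennreal (Pr p D) * emeasure (law p) ?X"
    using emeasure_restricted[OF X X] by simp
  then have "ennreal (Pr p D) = ennreal (Pr p D * Pr p D)"
    using Pr_nonneg by (simp add: law.emeasure_eq_measure Pr_def ennreal_mult)
  then have "Pr p D = Pr p D * Pr p D"
    using Pr_nonneg by (subst (asm) ennreal_inj) auto
  then show ?thesis by auto
qed

end

section \<open>Exploring a finite cluster\<close>

locale site_graph = bernoulli_sites V
  for V :: "'a set" +
  fixes E :: "('a \<times> 'a) set"
  assumes edges_subset: "E \<subseteq> V \<times> V"
    and sym_edges: "sym E"
    and finite_nbrs: "finite (E `` {v})"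
begin

lemma cluster_subset_sites: "S \<subseteq> V \<Longrightarrow> cluster E S x \<subseteq> V"
  using cluster_subset[of E S x] by blast

text \<open>
  Throughout, \<open>S \<union> R - C\<close> is the configuration \<open>S\<close> after the sites in \<open>R\<close> have been set open and those in
  \<open>C\<close> closed. It describes what remains random once the states in \<open>R \<union> C\<close> have been revealed.
\<close>

lemma finitary_cluster: "finitary (\<lambda>S. y \<in> cluster E (S \<union> R - C) x)"
  unfolding finitary_def
proof (intro conjI allI impI)
  show "mono (\<lambda>S. y \<in> cluster E (S \<union> R - C) x)"
  proof (intro monoI le_boolI)
    fix S T :: "'a set" assume "S \<le> T"
    then have "S \<union> R - C \<subseteq> T \<union> R - C" by blast
    then show "y \<in> cluster E (S \<union> R - C) x \<Longrightarrow> y \<in> cluster E (T \<union> R - C) x"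
      using cluster_mono by fast
  qed
  fix S assume "y \<in> cluster E (S \<union> R - C) x"
  then obtain F where F: "finite F" "F \<subseteq> S \<union> R - C" "y \<in> cluster E F x"
    using cluster_finite_support by metis
  have "F \<subseteq> (F - R) \<union> R - C" using F(2) by blast
  then have "y \<in> cluster E ((F - R) \<union> R - C) x"
    using F(3) cluster_mono by fast
  then show "\<exists>F. finite F \<and> F \<subseteq> S \<and> y \<in> cluster E (F \<union> R - C) x"
    using F(1,2) by (intro exI[of _ "F - R"]) auto
qed

lemma finitary_Bex:
  assumes "\<And>i. i \<in> I \<Longrightarrow> finitary (A i)"
  shows "finitary (\<lambda>S. \<exists>i\<in>I. A i S)"
  unfolding finitary_def
proof (intro conjI allI impI)
  show "mono (\<lambda>S. \<exists>i\<in>I. A i S)"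
  proof (intro monoI le_boolI)
    fix S T :: "'a set" assume ST: "S \<le> T" and "\<exists>i\<in>I. A i S"
    then obtain i where i: "i \<in> I" "A i S" by blast
    then show "\<exists>i\<in>I. A i T" using finitary_mono[OF assms[OF i(1)] ST i(2)] by blast
  qed
  fix S assume "\<exists>i\<in>I. A i S"
  then obtain i where i: "i \<in> I" "A i S" by blast
  then obtain F where "finite F" "F \<subseteq> S" "A i F" using assms unfolding finitary_def by meson
  then show "\<exists>F. finite F \<and> F \<subseteq> S \<and> (\<exists>i\<in>I. A i F)" using i(1) by blast
qed

lemma finite_iff_subset_window:
  assumes "A \<subseteq> V"
  shows "finite A \<longleftrightarrow> (\<exists>n. A \<subseteq> window n)"
  using assms finite_subset_window finite_subset finite_window by metis

lemma finitary_leaves_window: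
  "finitary (\<lambda>S. \<exists>y\<in>V - window n. y \<in> cluster E (S \<union> R - C) x)"
  by (intro finitary_Bex finitary_cluster)

lemma leaves_window_iff:
  assumes "S \<subseteq> V" "R \<subseteq> V"
  shows "(\<exists>y\<in>V - window n. y \<in> cluster E (S \<union> R - C) x) \<longleftrightarrow> \<not> cluster E (S \<union> R - C) x \<subseteq> window n"
  using cluster_subset_sites[of "S \<union> R - C" x] assms by blast

lemma infinite_cluster_iff:
  assumes "S \<subseteq> V" "R \<subseteq> V"
  shows "infinite (cluster E (S \<union> R - C) x) \<longleftrightarrow>
    (\<forall>n. \<exists>y\<in>V - window n. y \<in> cluster E (S \<union> R - C) x)"
proof -
  have "cluster E (S \<union> R - C) x \<subseteq> V"
    using cluster_subset_sites[of "S \<union> R - C" x] assms by blast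
  then show ?thesis
    unfolding leaves_window_iff[OF assms] by (simp add: finite_iff_subset_window)
qed

lemma event_leaves_window:
  assumes "R \<subseteq> V"
  shows "event (\<lambda>S. \<not> cluster E (S \<union> R - C) x \<subseteq> window n)"
proof -
  have "event (\<lambda>S. \<exists>y\<in>V - window n. y \<in> cluster E (S \<union> R - C) x)"
    by (rule event_finitary[OF finitary_leaves_window])
  moreover have "event (\<lambda>S. \<exists>y\<in>V - window n. y \<in> cluster E (S \<union> R - C) x) =
      event (\<lambda>S. \<not> cluster E (S \<union> R - C) x \<subseteq> window n)"
    by (rule event_cong, rule leaves_window_iff[OF _ assms])
  ultimately show ?thesis by simp
qed

lemma event_infinite_cluster:
  assumes "R \<subseteq> V"
  shows "event (\<lambda>S. infinite (cluster E (S \<union> R - C) x))"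
proof -
  have "event (\<lambda>S. \<forall>n\<in>UNIV. \<exists>y\<in>V - window n. y \<in> cluster E (S \<union> R - C) x)"
    by (intro event_Ball event_finitary[OF finitary_leaves_window]) auto
  moreover have "event (\<lambda>S. \<forall>n\<in>UNIV. \<exists>y\<in>V - window n. y \<in> cluster E (S \<union> R - C) x) =
      event (\<lambda>S. infinite (cluster E (S \<union> R - C) x))"
    by (rule event_cong) (use infinite_cluster_iff[OF _ assms] in simp)
  ultimately show ?thesis by simp
qed

lemma infinite_clusters_harris:
  assumes "R \<subseteq> V" "R' \<subseteq> V" "p \<in> {0..1}"
  shows "Pr p (\<lambda>S. \<not> infinite (cluster E (S \<union> R - C) x)) * Pr p (\<lambda>S. \<not> infinite (cluster E (S \<union> R' - C') x'))
    \<le> Pr p (\<lambda>S. \<not> infinite (cluster E (S \<union> R - C) x) \<and> \<not> infinite (cluster E (S \<union> R' - C') x'))"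
proof (rule Pr_neither[OF event_infinite_cluster[OF assms(1)] event_infinite_cluster[OF assms(2)]])
  let ?A = "\<lambda>n S. \<exists>y\<in>V - window n. y \<in> cluster E (S \<union> R - C) x"
  let ?B = "\<lambda>n S. \<exists>y\<in>V - window n. y \<in> cluster E (S \<union> R' - C') x'"
  have eq: "Pr p (\<lambda>S. infinite (cluster E (S \<union> R - C) x)) = Pr p (\<lambda>S. \<forall>n. ?A n S)"
    "Pr p (\<lambda>S. infinite (cluster E (S \<union> R' - C') x')) = Pr p (\<lambda>S. \<forall>n. ?B n S)"
    "Pr p (\<lambda>S. infinite (cluster E (S \<union> R - C) x) \<and> infinite (cluster E (S \<union> R' - C') x')) =
      Pr p (\<lambda>S. (\<forall>n. ?A n S) \<and> (\<forall>n. ?B n S))"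
    by (rule Pr_cong, simp only: infinite_cluster_iff assms(1,2))+
  have "Pr p (\<lambda>S. \<forall>n. ?A n S) * Pr p (\<lambda>S. \<forall>n. ?B n S) \<le> Pr p (\<lambda>S. (\<forall>n. ?A n S) \<and> (\<forall>n. ?B n S))"
  proof (rule harris[OF finitary_leaves_window finitary_leaves_window assms(3)])
    show "\<exists>y\<in>V - window n. y \<in> cluster E (S \<union> R - C) x"
      if "\<exists>y\<in>V - window (Suc n). y \<in> cluster E (S \<union> R - C) x" for n S
      using that window_Suc[of n] by blast
    show "\<exists>y\<in>V - window n. y \<in> cluster E (S \<union> R' - C') x'"
      if "\<exists>y\<in>V - window (Suc n). y \<in> cluster E (S \<union> R' - C') x'" for n S
      using that window_Suc[of n] by blast
  qed
  then show "Pr p (\<lambda>S. infinite (cluster E (S \<union> R - C) x)) * Pr p (\<lambda>S. infinite (cluster E (S \<union> R' - C') x'))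
      \<le> Pr p (\<lambda>S. infinite (cluster E (S \<union> R - C) x) \<and> infinite (cluster E (S \<union> R' - C') x'))"
    unfolding eq .
qed

definition \<theta> :: "real \<Rightarrow> 'a \<Rightarrow> real" where
  "\<theta> p v = Pr p (\<lambda>S. infinite (cluster E S v))"

lemma event_infinite: "event (\<lambda>S. infinite (cluster E S v))"
  using event_infinite_cluster[of "{}" "{}" v] by simp

text \<open>
  A site has an infinite cluster if it is open and would have one if it were opened; the latter does
  not depend on its own state.
\<close>

lemma \<theta>_eq:
  assumes "v \<in> V" "p \<in> {0..1}"
  shows "\<theta> p v = p * Pr p (\<lambda>S. infinite (cluster E (S \<union> {v} - {}) v))"
proof -
  have "cluster E (S - {v}) v = {}" for S
    using cluster_nonempty_iff[of E "S - {v}" v] by blast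
  then show ?thesis
    unfolding \<theta>_def using Pr_condition_site[OF assms(1) event_infinite assms(2), of v]
    by (simp add: Pr_const)
qed

text \<open>
  The cluster of \<open>x\<close> stays finite when \<open>v\<close> is opened if it is finite with \<open>v\<close> closed and the cluster
  that \<open>v\<close> would have is finite. Both events are decreasing, so by positive association their joint
  probability is at least the product, and the second has probability \<open>1 - \<theta> p v / p\<close> when \<open>p > 0\<close>.
\<close>

lemma opening_site_keeps_finite:
  assumes R: "x \<in> R" "R \<subseteq> V" "R \<subseteq> cluster E R x" "R \<inter> C = {}"
    and v: "v \<in> V" "v \<notin> R" "v \<notin> C" and p: "p \<in> {0..1}"
  shows "(p - \<theta> p v) * Pr p (\<lambda>S. \<not> infinite (cluster E (S \<union> R - insert v C) x))
    \<le> p * Pr p (\<lambda>S. \<not> infinite (cluster E (S \<union> insert v R - C) x))"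
proof -
  let ?a = "Pr p (\<lambda>S. \<not> infinite (cluster E (S \<union> insert v R - C) x))"
  let ?b = "Pr p (\<lambda>S. \<not> infinite (cluster E (S \<union> R - insert v C) x))"
  let ?t = "Pr p (\<lambda>S. infinite (cluster E (S \<union> {v} - {}) v))"
  have "?b * (1 - ?t) = ?b * Pr p (\<lambda>S. \<not> infinite (cluster E (S \<union> {v} - {}) v))"
    using Pr_Not[OF event_infinite_cluster[of "{v}" "{}" v]] v(1) by simp
  also have "\<dots> \<le> Pr p (\<lambda>S. \<not> infinite (cluster E (S \<union> R - insert v C) x) \<and>
      \<not> infinite (cluster E (S \<union> {v} - {}) v))"
    by (rule infinite_clusters_harris) (use R v p in auto)
  also have "\<dots> \<le> ?a"
  proof (rule Pr_mono)
    show "event (\<lambda>S. \<not> infinite (cluster E (S \<union> insert v R - C) x))"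
      by (rule event_Not[OF event_infinite_cluster]) (use R v in auto)
    fix S assume S: "\<not> infinite (cluster E (S \<union> R - insert v C) x) \<and> \<not> infinite (cluster E (S \<union> {v} - {}) v)"
    have "cluster E (insert v (S \<union> R - C)) x \<subseteq>
        cluster E (S \<union> R - C - {v}) x \<union> cluster E (insert v S) v"
      using R v by (intro cluster_insert_subset) auto
    moreover have "S \<union> insert v R - C = insert v (S \<union> R - C)"
      "S \<union> R - insert v C = S \<union> R - C - {v}" "S \<union> {v} - {} = insert v S"
      using v by auto
    ultimately show "\<not> infinite (cluster E (S \<union> insert v R - C) x)"
      using S by (metis finite_UnI finite_subset)
  qed
  finally have "p * (?b * (1 - ?t)) \<le> p * ?a"
    using p by (intro mult_left_mono) auto
  moreover have "p * (?b * (1 - ?t)) = (p - \<theta> p v) * ?b"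
    unfolding \<theta>_eq[OF v(1) p] by (simp add: algebra_simps)
  ultimately show ?thesis by (simp only:)
qed

lemma cluster_closed_boundary:
  assumes "x \<in> R" "E `` R \<subseteq> R \<union> C"
  shows "cluster E (S \<union> R - C) x \<subseteq> R"
proof
  fix y assume "y \<in> cluster E (S \<union> R - C) x"
  then show "y \<in> R"
    by induction (use assms in auto)
qed

text \<open>
  Conditionally on the cluster of \<open>x\<close> being finite under \<open>p\<close>, it leaves \<open>W\<close> at least as likely as under
  \<open>p'\<close> without conditioning. The induction reveals one site at a time: \<open>R\<close> and \<open>C\<close> are
  the sites found open and closed so far, \<open>R\<close> is connected and contains \<open>x\<close>, and the next site is
  an unrevealed neighbour of \<open>R\<close>. The exploration stops once \<open>R\<close> has left \<open>W\<close> or has no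
  unrevealed neighbours; either way the first event is then decided. Starting with \<open>F \<subseteq> C\<close> ensures
  that only sites with small \<open>\<theta> p\<close> are ever revealed.
\<close>

lemma finite_cluster_dominates:
  assumes W: "W = window n" and p: "0 \<le> p'" "p' \<le> p" "p \<le> 1"
    and \<theta>: "\<And>v. v \<in> V - F \<Longrightarrow> \<theta> p v \<le> p - p'"
    and RC: "x \<in> R" "R \<subseteq> V" "R \<subseteq> cluster E R x" "R \<inter> C = {}" "F \<subseteq> C"
  shows "Pr p' (\<lambda>S. \<not> cluster E (S \<union> R - C) x \<subseteq> W) * Pr p (\<lambda>S. \<not> infinite (cluster E (S \<union> R - C) x))
    \<le> Pr p (\<lambda>S. \<not> cluster E (S \<union> R - C) x \<subseteq> W \<and> \<not> infinite (cluster E (S \<union> R - C) x))"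
  using RC
proof (induction "card (W \<union> E `` W - (R \<union> C))" arbitrary: R C rule: less_induct)
  case (less R C)
  let ?Q = "\<lambda>R C S. \<not> cluster E (S \<union> R - C) x \<subseteq> W"
  let ?N = "\<lambda>R C S. \<not> infinite (cluster E (S \<union> R - C) x)"
  have finN: "finite (W \<union> E `` W - A)" for A
  proof -
    have "E `` W = (\<Union>v\<in>W. E `` {v})" by blast
    then show ?thesis unfolding W using finite_window finite_nbrs by auto
  qed
  have pp: "p \<in> {0..1}" "p' \<in> {0..1}" using p by auto
  have evQ: "event (?Q R C)" and evN: "event (?N R C)" if "R \<subseteq> V" for R C
    unfolding W by (rule event_leaves_window[OF that], rule event_Not[OF event_infinite_cluster[OF that]])
  consider "\<not> R \<subseteq> W" | "E `` R \<subseteq> R \<union> C" "R \<subseteq> W" | "R \<subseteq> W" "\<not> E `` R \<subseteq> R \<union> C" by blast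
  then show ?case
  proof cases
    case 1
    have "?Q R C S" for S
    proof -
      have "R \<subseteq> cluster E (S \<union> R - C) x"
        using less.prems(3,4) cluster_mono[of R "S \<union> R - C" E x] by blast
      then show ?thesis using 1 by blast
    qed
    then show ?thesis by (simp add: Pr_const)
  next
    case 2
    have "\<not> ?Q R C S" for S
      using cluster_closed_boundary[OF less.prems(1) 2(1), of S] 2(2) by blast
    then show ?thesis by (simp add: Pr_const)
  next
    case 3
    then obtain u v where uv: "u \<in> R" "(u, v) \<in> E" "v \<notin> R" "v \<notin> C" by blast
    have v: "v \<in> V" using uv edges_subset by blast
    have vW: "v \<in> E `` W" using uv 3 by blast
    have R': "insert v R \<subseteq> V" using v less.prems(2) by blast
    have open_eq: "insert v S \<union> R - C = S \<union> insert v R - C" for S by blast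
    have closed_eq: "(S - {v}) \<union> R - C = S \<union> R - insert v C" for S using uv(3) by blast
    have less1: "card (W \<union> E `` W - (insert v R \<union> C)) < card (W \<union> E `` W - (R \<union> C))"
      "card (W \<union> E `` W - (R \<union> insert v C)) < card (W \<union> E `` W - (R \<union> C))"
      by (rule psubset_card_mono[OF finN], use vW uv(3,4) in blast)+
    have grow: "insert v R \<subseteq> cluster E (insert v R) x"
    proof -
      have "R \<subseteq> cluster E (insert v R) x"
        using less.prems(3) cluster_mono[of R "insert v R" E x] by blast
      then show ?thesis using uv by (auto intro: cluster_step)
    qed
    \<comment> \<open>\<open>q1\<close>, \<open>q0\<close> and \<open>a\<close>, \<open>b\<close> are the probabilities of leaving \<open>W\<close> under \<open>p'\<close> and of
      finiteness under \<open>p\<close>, for \<open>v\<close> open and for \<open>v\<close> closed.\<close>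
    define q1 q0 where "q1 = Pr p' (?Q (insert v R) C)" and "q0 = Pr p' (?Q R (insert v C))"
    define a b where "a = Pr p (?N (insert v R) C)" and "b = Pr p (?N R (insert v C))"
    have IH1: "q1 * a \<le> Pr p (\<lambda>S. ?Q (insert v R) C S \<and> ?N (insert v R) C S)"
      unfolding q1_def a_def
      by (rule less.hyps[OF less1(1)]) (use less.prems R' grow uv in auto)
    have IH0: "q0 * b \<le> Pr p (\<lambda>S. ?Q R (insert v C) S \<and> ?N R (insert v C) S)"
      unfolding q0_def b_def
      by (rule less.hyps[OF less1(2)]) (use less.prems uv in auto)
    have subset: "cluster E (S \<union> R - insert v C) x \<subseteq> cluster E (S \<union> insert v R - C) x" for S
      by (rule cluster_mono) blast
    have q: "q0 \<le> q1"
      unfolding q0_def q1_def by (rule Pr_mono[OF evQ[OF R']]) (use subset in blast)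
    have ab: "a \<le> b"
      unfolding a_def b_def by (rule Pr_mono[OF evN[OF less.prems(2)]]) (use finite_subset[OF subset] in blast)
    have "v \<in> V - F" using v uv(4) less.prems(5) by blast
    then have "p' * b \<le> (p - \<theta> p v) * b"
      using \<theta>[of v] Pr_nonneg unfolding b_def by (intro mult_right_mono) auto
    also have "\<dots> \<le> p * a"
      unfolding a_def b_def by (rule opening_site_keeps_finite) (use less.prems uv v pp in auto)
    finally have pa: "p' * b \<le> p * a" .
    \<comment> \<open>Given finiteness, \<open>v\<close> is open with probability \<open>p * a / (p * a + (1 - p) * b)\<close>. This is at
      least \<open>p'\<close>, and \<open>q1 \<ge> q0\<close> rewards the larger weight.\<close>
    have "p' * (p * a + (1 - p) * b) \<le> p' * b"
      using mult_left_mono[OF ab, of p] p by (intro mult_left_mono) (simp_all add: algebra_simps)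
    with pa q have "0 \<le> q1 - q0" "0 \<le> p * a - p' * (p * a + (1 - p) * b)"
      by linarith+
    then have "0 \<le> (q1 - q0) * (p * a - p' * (p * a + (1 - p) * b))"
      by (rule mult_nonneg_nonneg)
    then have "(p' * q1 + (1 - p') * q0) * (p * a + (1 - p) * b) \<le> p * (q1 * a) + (1 - p) * (q0 * b)"
      by (simp add: algebra_simps)
    also have "\<dots> \<le> p * Pr p (\<lambda>S. ?Q (insert v R) C S \<and> ?N (insert v R) C S)
        + (1 - p) * Pr p (\<lambda>S. ?Q R (insert v C) S \<and> ?N R (insert v C) S)"
      using IH1 IH0 p by (intro add_mono mult_left_mono) auto
    also have "\<dots> = Pr p (\<lambda>S. ?Q R C S \<and> ?N R C S)"
      using Pr_condition_site[OF v event_conj[OF evQ[OF less.prems(2), of C] evN[OF less.prems(2), of C]] pp(1),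
          unfolded open_eq closed_eq, symmetric] .
    also have "p' * q1 + (1 - p') * q0 = Pr p' (?Q R C)"
      using Pr_condition_site[OF v evQ[OF less.prems(2), of C] pp(2),
          unfolded open_eq closed_eq, symmetric] unfolding q1_def q0_def .
    also have "p * a + (1 - p) * b = Pr p (?N R C)"
      using Pr_condition_site[OF v evN[OF less.prems(2), of C] pp(1),
          unfolded open_eq closed_eq, symmetric] unfolding a_def b_def .
    finally show ?thesis .
  qed
qed

text \<open>
  Let \<open>W\<close> grow in \<open>finite_cluster_dominates\<close>. A finite cluster cannot leave all windows, so the
  right-hand side tends to \<open>0\<close>, whereas the left-hand side is at least the probability in question
  times the positive probability that the cluster is finite under \<open>p\<close>.
\<close>

lemma small_\<theta>_no_infinite_cluster:
  assumes p: "0 \<le> p'" "p' \<le> p" "p \<le> 1"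
    and \<theta>: "\<And>v. v \<in> V - F \<Longrightarrow> \<theta> p v \<le> p - p'" "\<theta> p x < p"
    and x: "x \<in> V - F"
  shows "Pr p' (\<lambda>S. infinite (cluster E (S \<union> {x} - F) x)) = 0"
proof -
  let ?I = "\<lambda>S. infinite (cluster E (S \<union> {x} - F) x)"
  let ?Q = "\<lambda>n S. \<not> cluster E (S \<union> {x} - F) x \<subseteq> window n"
  have xV: "{x} \<subseteq> V" and pp: "p \<in> {0..1}" using x p by auto
  have ev: "event ?I" "event (?Q n)" for n
    by (rule event_infinite_cluster[OF xV], rule event_leaves_window[OF xV])
  have le: "Pr p' ?I * Pr p (\<lambda>S. \<not> ?I S) \<le> Pr p (\<lambda>S. ?Q n S \<and> \<not> ?I S)" for n
  proof -
    have "Pr p' ?I \<le> Pr p' (?Q n)"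
      by (rule Pr_mono[OF ev(2)]) (use finite_subset[OF _ finite_window[of n]] in blast)
    then have "Pr p' ?I * Pr p (\<lambda>S. \<not> ?I S) \<le> Pr p' (?Q n) * Pr p (\<lambda>S. \<not> ?I S)"
      by (intro mult_right_mono Pr_nonneg)
    also have "\<dots> \<le> Pr p (\<lambda>S. ?Q n S \<and> \<not> ?I S)"
      by (rule finite_cluster_dominates[OF refl p \<theta>(1)]) (use x in \<open>auto intro: cluster_self\<close>)
    finally show ?thesis .
  qed
  have "(\<lambda>n. Pr p (\<lambda>S. ?Q n S \<and> \<not> ?I S)) \<longlonglongrightarrow> Pr p (\<lambda>S. \<forall>n. ?Q n S \<and> \<not> ?I S)"
  proof (rule Pr_decseq)
    show "event (\<lambda>S. ?Q n S \<and> \<not> ?I S)" for n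
      by (intro event_conj event_Not ev)
    show "?Q n S \<and> \<not> ?I S" if "?Q (Suc n) S \<and> \<not> ?I S" for n S
      using that window_Suc[of n] by blast
  qed
  moreover have "Pr p (\<lambda>S. \<forall>n. ?Q n S \<and> \<not> ?I S) = Pr p (\<lambda>_. False)"
  proof (rule Pr_cong, rule iffI)
    fix S assume S: "S \<subseteq> V" "\<forall>n. ?Q n S \<and> \<not> ?I S"
    have "cluster E (S \<union> {x} - F) x \<subseteq> V"
      using S(1) xV by (intro cluster_subset_sites) blast
    then show False using S(2) finite_iff_subset_window by blast
  qed simp
  ultimately have "(\<lambda>n. Pr p (\<lambda>S. ?Q n S \<and> \<not> ?I S)) \<longlonglongrightarrow> 0" by (simp add: Pr_const)
  then have "Pr p' ?I * Pr p (\<lambda>S. \<not> ?I S) \<le> 0"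
    by (rule LIMSEQ_le_const) (use le in blast)
  moreover have "0 < Pr p (\<lambda>S. \<not> ?I S)"
  proof -
    let ?t = "Pr p (\<lambda>S. infinite (cluster E (S \<union> {x} - {}) x))"
    have "p * ?t < p" using \<theta>(2) \<theta>_eq[of x p] x pp by simp
    then have "?t \<noteq> 1" by auto
    then have "?t < 1" using Pr_le_1[of p "\<lambda>S. infinite (cluster E (S \<union> {x} - {}) x)"] by linarith
    moreover have "Pr p ?I \<le> ?t"
    proof (rule Pr_mono[OF event_infinite_cluster[OF xV]])
      fix S assume "?I S"
      moreover have "cluster E (S \<union> {x} - F) x \<subseteq> cluster E (S \<union> {x} - {}) x"
        by (rule cluster_mono) blast
      ultimately show "infinite (cluster E (S \<union> {x} - {}) x)" by (meson finite_subset)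
    qed
    ultimately show ?thesis using Pr_Not[OF ev(1)] by simp
  qed
  ultimately have "Pr p' ?I \<le> 0" by (meson mult_pos_pos not_le)
  then show ?thesis using Pr_nonneg[of p' ?I] by (rule order_antisym)
qed

lemma Pr_eq_1_iff: "event Q \<Longrightarrow> Pr p Q = 1 \<longleftrightarrow> (AE \<omega> in law p. Q (opens \<omega>))"
  unfolding Pr_def by (rule law.prob_Collect_eq_1[OF event_sets])

text \<open>
  Were \<open>\<theta> p\<close> at most \<open>c\<close> off \<open>F\<close>, no site outside \<open>F\<close> would have an infinite cluster avoiding \<open>F\<close> at the
  parameter \<open>p'\<close>. But an infinite cluster contains one that avoids \<open>F\<close>.
\<close>

lemma supercritical_\<theta>_far_away:
  assumes p: "0 \<le> p'" "p \<le> 1" "c < p - p'" and c: "0 \<le> c"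
    and inf: "AE \<omega> in law p'. \<exists>x\<in>V. infinite (cluster E (opens \<omega>) x)"
    and F: "finite F"
  shows "\<exists>v\<in>V - F. c < \<theta> p v"
proof (rule ccontr)
  assume "\<not> ?thesis"
  then have \<theta>: "\<theta> p v \<le> c" if "v \<in> V - F" for v using that by force
  have "AE \<omega> in law p'. \<forall>x\<in>V - F. \<not> infinite (cluster E (opens \<omega> \<union> {x} - F) x)"
  proof (rule AE_ball_countable'[OF _ countable_Diff[OF countable_sites]])
    fix x assume x: "x \<in> V - F"
    let ?I = "\<lambda>S. infinite (cluster E (S \<union> {x} - F) x)"
    have ev: "event ?I"
      using x by (intro event_infinite_cluster) blast
    have "Pr p' ?I = 0"
    proof (rule small_\<theta>_no_infinite_cluster[where p = p, OF p(1) _ p(2) _ _ x])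
      show "\<theta> p v \<le> p - p'" if "v \<in> V - F" for v using \<theta>[OF that] p by simp
      show "p' \<le> p" "\<theta> p x < p" using c \<theta>[OF x] p by simp_all
    qed
    then have "Pr p' (\<lambda>S. \<not> ?I S) = 1"
      using Pr_Not[OF ev, of p'] by linarith
    then show "AE \<omega> in law p'. \<not> infinite (cluster E (opens \<omega> \<union> {x} - F) x)"
      using Pr_eq_1_iff[OF event_Not[OF ev], of p'] by blast
  qed
  with inf have "AE \<omega> in law p'. False"
  proof eventually_elim
    case (elim \<omega>)
    then obtain x where "infinite (cluster E (opens \<omega>) x)" by blast
    then obtain y where "y \<in> opens \<omega> - F" "infinite (cluster E (opens \<omega> - F) y)"
      using infinite_cluster_outside_finite[OF _ F finite_nbrs] by blast
    moreover have "opens \<omega> \<union> {y} = opens \<omega>" using calculation(1) by blast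
    ultimately show False using elim(2) opens_subset[of \<omega>] by (metis Diff_iff subsetD)
  qed
  then show False by (simp add: law.AE_False)
qed

section \<open>Infinitely many infinite clusters\<close>

text \<open>
  Only finitely many clusters meet a finite set, so this expresses that there are infinitely many
  infinite clusters. In this form it is visibly measurable and stable under finite changes.
\<close>

definition spread :: "'a set \<Rightarrow> bool" where
  "spread S \<longleftrightarrow> (\<forall>n. \<exists>x\<in>V. infinite (cluster E S x) \<and> cluster E S x \<inter> window n = {})"

lemma spread_finite_change:
  assumes "S - {v} = T - {v}" "v \<in> V" "spread S"
  shows "spread T"
  unfolding spread_def
proof
  fix n
  have "finite ({v} \<union> E `` {v} \<union> window n)"
    using finite_nbrs finite_window by simp
  moreover have "{v} \<union> E `` {v} \<union> window n \<subseteq> V"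
    using window_subset edges_subset assms(2) by blast
  ultimately have "\<exists>m. {v} \<union> E `` {v} \<union> window n \<subseteq> window m"
    by (rule finite_subset_window)
  then obtain m where m: "{v} \<union> E `` {v} \<union> window n \<subseteq> window m" ..
  obtain x where x: "x \<in> V" "infinite (cluster E S x)" "cluster E S x \<inter> window m = {}"
    using assms(3) unfolding spread_def by blast
  have "x \<in> S" using infinite_imp_nonempty[OF x(2)] cluster_nonempty_iff[of E S x] by simp
  moreover have "cluster E S x \<inter> ({v} \<union> E `` {v}) = {}" using x(3) m by blast
  ultimately have "cluster E T x = cluster E S x"
    using cluster_away[OF assms(1) _ sym_edges] by simp
  moreover have "cluster E S x \<inter> window n = {}" using x(3) m by blast
  ultimately show "\<exists>x\<in>V. infinite (cluster E T x) \<and> cluster E T x \<inter> window n = {}"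
    using x(1,2) by (intro bexI[of _ x]) simp_all
qed

lemma spread_infinitely_many:
  assumes "S \<subseteq> V" "spread S"
  shows "infinite {C. infinite C \<and> (\<exists>x\<in>S. C = cluster E S x)}"
proof
  let ?I = "{C. infinite C \<and> (\<exists>x\<in>S. C = cluster E S x)}"
  assume "finite ?I"
  define r where "r C = (SOME x. x \<in> C)" for C :: "'a set"
  have r: "r C \<in> C" if "C \<in> ?I" for C
    unfolding r_def using that infinite_imp_nonempty[of C] by (simp add: some_in_eq)
  have "finite (r ` ?I)" using \<open>finite ?I\<close> by (rule finite_imageI)
  moreover have "r ` ?I \<subseteq> V" using r cluster_subset_sites[OF assms(1)] by blast
  ultimately obtain n where n: "r ` ?I \<subseteq> window n" using finite_subset_window by blast
  obtain x where x: "infinite (cluster E S x)" "cluster E S x \<inter> window n = {}"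
    using assms(2) unfolding spread_def by blast
  have "x \<in> S" using infinite_imp_nonempty[OF x(1)] cluster_nonempty_iff[of E S x] by simp
  then have "cluster E S x \<in> ?I" using x(1) by blast
  then show False using r n x(2) by blast
qed

text \<open>
  Otherwise, by the zero-one law, a large window meets all infinite clusters with high probability,
  and a far vertex that lies in an infinite cluster with probability more than \<open>c\<close> would have to be
  connected to that window.
\<close>

theorem spread_almost_surely:
  assumes p: "p \<in> {0..1}" and c: "0 < c"
    and far: "\<And>F. finite F \<Longrightarrow> \<exists>v\<in>V - F. c < \<theta> p v"
    and decay: "\<And>x \<epsilon>. x \<in> V \<Longrightarrow> 0 < \<epsilon> \<Longrightarrow>
      \<exists>F. finite F \<and> (\<forall>y\<in>V - F. Pr p (\<lambda>S. y \<in> cluster E S x) \<le> \<epsilon>)"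
  shows "AE \<omega> in law p. spread (opens \<omega>)"
proof -
  let ?H = "\<lambda>n S. \<forall>x\<in>V. infinite (cluster E S x) \<longrightarrow> (\<exists>b\<in>window n. b \<in> cluster E S x)"
  have ev_cluster: "event (\<lambda>S. y \<in> cluster E S x)" for x y
    using event_finitary[OF finitary_cluster[of y "{}" "{}" x]] by simp
  have ev_meets: "event (\<lambda>S. \<exists>b\<in>window n. b \<in> cluster E S x)" for n x
    by (intro event_Bex ev_cluster countable_finite finite_window)
  have ev_N: "event (\<lambda>S. \<not> (infinite (cluster E S x) \<and> \<not> (\<exists>b\<in>window n. b \<in> cluster E S x)))" for n x
    by (intro event_Not event_conj event_infinite ev_meets)
  have ev_H: "event (?H n)" for n
  proof -
    have "event (\<lambda>S. \<forall>x\<in>V. \<not> (infinite (cluster E S x) \<and> \<not> (\<exists>b\<in>window n. b \<in> cluster E S x)))"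
      by (rule event_Ball[OF countable_sites ev_N])
    then show ?thesis unfolding imp_conv_disj de_Morgan_conj not_not .
  qed
  have spread_iff: "spread S \<longleftrightarrow> (\<forall>n\<in>UNIV. \<not> ?H n S)" for S
    unfolding spread_def by blast
  have ev_spread: "event spread"
    unfolding spread_iff[abs_def] by (intro event_Ball event_Not ev_H) simp
  have "Pr p spread = 0 \<or> Pr p spread = 1"
  proof (rule zero_one_law[OF ev_spread _ _ p])
    fix v S assume v: "v \<in> V"
    have "insert v S - {v} = S - {v}" "S - {v} - {v} = S - {v}" by auto
    then show "spread (insert v S) = spread S" "spread (S - {v}) = spread S"
      by (blast intro: spread_finite_change[OF _ v] dest: sym)+
  qed
  moreover have "Pr p spread \<noteq> 0"
  proof
    assume zero: "Pr p spread = 0"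
    have "(\<lambda>n. Pr p (?H n)) \<longlonglongrightarrow> Pr p (\<lambda>S. \<exists>n. ?H n S)"
    proof (rule Pr_incseq[OF ev_H])
      show "?H (Suc n) S" if "?H n S" for n S using that window_Suc[of n] by blast
    qed
    moreover have "(\<lambda>S. \<exists>n. ?H n S) = (\<lambda>S. \<not> spread S)"
      by (intro ext) (unfold spread_iff, blast)
    ultimately have "(\<lambda>n. Pr p (?H n)) \<longlonglongrightarrow> 1" using zero Pr_Not[OF ev_spread] by simp
    moreover have "1 - c / 2 < 1" using c by simp
    ultimately have "\<forall>\<^sub>F n in sequentially. 1 - c / 2 < Pr p (?H n)"
      by (rule order_tendstoD(1))
    then obtain n where n: "1 - c / 2 < Pr p (?H n)"
      by (auto simp: eventually_sequentially)
    \<comment> \<open>Chosen so that the sum over the window is at most \<open>c / 2\<close>; the \<open>1\<close> covers an empty window.\<close>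
    define \<epsilon> where "\<epsilon> = c / (2 * (real (card (window n)) + 1))"
    have \<epsilon>: "0 < \<epsilon>" using c by (simp add: \<epsilon>_def)
    have "\<forall>b\<in>window n. \<exists>F. finite F \<and> (\<forall>y\<in>V - F. Pr p (\<lambda>S. y \<in> cluster E S b) \<le> \<epsilon>)"
      using decay[OF _ \<epsilon>] window_subset by blast
    then obtain F where F: "\<forall>b\<in>window n. finite (F b) \<and> (\<forall>y\<in>V - F b. Pr p (\<lambda>S. y \<in> cluster E S b) \<le> \<epsilon>)"
      by metis
    have "finite (\<Union>b\<in>window n. F b)" using F finite_window by blast
    then obtain v where v: "v \<in> V" "v \<notin> (\<Union>b\<in>window n. F b)" "c < \<theta> p v"
      using far[of "\<Union>b\<in>window n. F b"] by blast
    let ?M = "\<lambda>S. \<exists>b\<in>window n. v \<in> cluster E S b"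
    have ev_M: "event ?M"
      by (intro event_Bex ev_cluster countable_finite finite_window)
    have "\<theta> p v = Pr p (\<lambda>S. infinite (cluster E S v) \<and> ?H n S) + Pr p (\<lambda>S. infinite (cluster E S v) \<and> \<not> ?H n S)"
      unfolding \<theta>_def by (rule Pr_split[OF event_infinite ev_H])
    also have "\<dots> \<le> Pr p ?M + Pr p (\<lambda>S. \<not> ?H n S)"
    proof (rule add_mono)
      show "Pr p (\<lambda>S. infinite (cluster E S v) \<and> ?H n S) \<le> Pr p ?M"
        by (rule Pr_mono[OF ev_M]) (use v(1) cluster_sym[OF sym_edges] in blast)
      show "Pr p (\<lambda>S. infinite (cluster E S v) \<and> \<not> ?H n S) \<le> Pr p (\<lambda>S. \<not> ?H n S)"
        by (rule Pr_mono[OF event_Not[OF ev_H]]) blast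
    qed
    also have "Pr p ?M \<le> (\<Sum>b\<in>window n. Pr p (\<lambda>S. v \<in> cluster E S b))"
      by (rule Pr_Bex_le[OF finite_window ev_cluster])
    also have "\<dots> \<le> real (card (window n)) * \<epsilon>"
      using F v(1,2) by (intro sum_bounded_above) blast
    also have "\<dots> \<le> c / 2"
      using c by (simp add: \<epsilon>_def field_simps)
    finally show False using n v(3) Pr_Not[OF ev_H[of n]] by simp
  qed
  ultimately show ?thesis using Pr_eq_1_iff[OF ev_spread] by simp
qed
end

section \<open>Percolation on a locally finite graph\<close>

lemma cluster_eq_reachable:
  "v \<in> cluster (arcs_ends G) S u \<longleftrightarrow> u \<rightarrow>\<^sup>*\<^bsub>G \<restriction> S\<^esub> v"
proof
  have ends: "(x, y) \<in> arcs_ends (G \<restriction> S)" if "(x, y) \<in> arcs_ends G" "x \<in> S" "y \<in> S" for x y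
    using that by (auto simp: arcs_ends_conv)
  assume "v \<in> cluster (arcs_ends G) S u"
  then have "(u, v) \<in> rtrancl_on S (arcs_ends (G \<restriction> S))"
  proof induction
    case (cluster_step y z)
    then have "y \<in> S" using cluster_subset by fast
    then have "(y, z) \<in> arcs_ends (G \<restriction> S)" using cluster_step.hyps by (intro ends)
    then show ?case using cluster_step by (auto intro: rtrancl_on_into_rtrancl_on)
  qed auto
  then show "u \<rightarrow>\<^sup>*\<^bsub>G \<restriction> S\<^esub> v" by (simp add: reachable_def)
next
  assume "u \<rightarrow>\<^sup>*\<^bsub>G \<restriction> S\<^esub> v"
  then have "(u, v) \<in> rtrancl_on S (arcs_ends (G \<restriction> S))" by (simp add: reachable_def)
  then show "v \<in> cluster (arcs_ends G) S u"
    by induction (auto intro: cluster_self cluster_converse_step dest: dominates_induce_subgraphD)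
qed

context sym_digraph
begin

lemma sym_arcs_ends: "sym (arcs_ends G)"
  using sym_arcs by (simp add: symmetric_def)

lemma open_clusters_conv:
  "open_clusters G \<omega> = cluster (arcs_ends G) {v \<in> verts G. \<omega> v} ` {v \<in> verts G. \<omega> v}"
proof -
  let ?S = "{v \<in> verts G. \<omega> v}"
  interpret H: wf_digraph "G \<restriction> ?S" by auto
  have "pre_digraph.scc_of (G \<restriction> ?S) u = cluster (arcs_ends G) ?S u" for u
    unfolding pre_digraph.scc_of_def cluster_eq_reachable[symmetric]
    using cluster_sym[OF sym_arcs_ends] by fast
  then show ?thesis
    unfolding open_clusters_def H.sccs_verts_conv_scc_of by simp
qed

lemma same_open_cluster_conv:
  "same_open_cluster G \<omega> x y \<longleftrightarrow> y \<in> cluster (arcs_ends G) {v \<in> verts G. \<omega> v} x"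
  unfolding same_open_cluster_def open_clusters_conv
proof
  let ?S = "{v \<in> verts G. \<omega> v}"
  assume "\<exists>C\<in>cluster (arcs_ends G) ?S ` ?S. x \<in> C \<and> y \<in> C"
  then obtain z where "x \<in> cluster (arcs_ends G) ?S z" "y \<in> cluster (arcs_ends G) ?S z" by blast
  then show "y \<in> cluster (arcs_ends G) ?S x"
    using cluster_eq[OF sym_arcs_ends] by metis
next
  let ?S = "{v \<in> verts G. \<omega> v}"
  assume y: "y \<in> cluster (arcs_ends G) ?S x"
  then have "x \<in> ?S" using cluster_nonempty_iff[of "arcs_ends G" ?S x] by blast
  then show "\<exists>C\<in>cluster (arcs_ends G) ?S ` ?S. x \<in> C \<and> y \<in> C"
    using y by (blast intro: cluster_self)
qed

lemma finite_nbrs_if_locally_finite: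
  assumes "locally_finite G"
  shows "finite (arcs_ends G `` {v})"
proof (cases "v \<in> verts G")
  case True
  then have "finite (head G ` out_arcs G v)" using assms by (simp add: locally_finite_def)
  moreover have "arcs_ends G `` {v} = head G ` out_arcs G v"
    by (auto simp: arcs_ends_conv out_arcs_def)
  ultimately show ?thesis by simp
next
  case False
  then have "arcs_ends G `` {v} = {}" using adj_in_verts by blast
  then show ?thesis by simp
qed

text \<open>
  Finiteness of balls makes the graph countable, and it lets a vertex that leaves every finite set
  go to infinite distance.
\<close>

lemma finite_walk_ball:
  assumes "locally_finite G"
  shows "finite {y. \<exists>w. awalk x w y \<and> length w \<le> n}"
proof (induction n arbitrary: x)
  case 0
  have "{y. \<exists>w. awalk x w y \<and> length w \<le> 0} \<subseteq> {x}" by (auto simp: awalk_Nil_iff)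
  then show ?case by (rule finite_subset) simp
next
  case (Suc n)
  have "{y. \<exists>w. awalk x w y \<and> length w \<le> Suc n} \<subseteq>
      insert x (\<Union>z\<in>arcs_ends G `` {x}. {y. \<exists>w. awalk z w y \<and> length w \<le> n})"
  proof
    fix y assume "y \<in> {y. \<exists>w. awalk x w y \<and> length w \<le> Suc n}"
    then obtain w where w: "awalk x w y" "length w \<le> Suc n" by blast
    show "y \<in> insert x (\<Union>z\<in>arcs_ends G `` {x}. {y. \<exists>w. awalk z w y \<and> length w \<le> n})"
    proof (cases w)
      case Nil
      then show ?thesis using w by (simp add: awalk_Nil_iff)
    next
      case (Cons e es)
      then have "e \<in> arcs G" "x = tail G e" "awalk (head G e) es y" "length es \<le> n"
        using w by (auto simp: awalk_Cons_iff)
      moreover have "(x, head G e) \<in> arcs_ends G"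
        using calculation by (auto simp: arcs_ends_conv)
      ultimately show ?thesis by blast
    qed
  qed
  then show ?case
    by (rule finite_subset) (simp add: Suc.IH finite_nbrs_if_locally_finite[OF assms])
qed

lemma connected_imp_awalk:
  assumes "Digraph_Component.connected G" "x \<in> verts G" "y \<in> verts G"
  shows "\<exists>w. awalk x w y"
proof -
  have "x \<rightarrow>\<^sup>*\<^bsub>mk_symmetric G\<^esub> y"
    using assms unfolding Digraph_Component.connected_def by (auto simp: strongly_connected_def)
  then have "x \<rightarrow>\<^sup>* y" by (simp only: reachable_mk_symmetric_eq[OF sym_arcs])
  then show ?thesis by (simp add: reachable_awalk)
qed

lemma countable_verts:
  assumes "Digraph_Component.connected G" "locally_finite G"
  shows "countable (verts G)"
proof (cases "verts G = {}")
  case False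
  then obtain x where x: "x \<in> verts G" by blast
  have "verts G \<subseteq> (\<Union>n. {y. \<exists>w. awalk x w y \<and> length w \<le> n})"
    using connected_imp_awalk[OF assms(1) x] by blast
  then show ?thesis
    by (rule countable_subset) (intro countable_UN countable_finite finite_walk_ball assms(2) countableI_type)
qed simp

lemma graph_dist_ge:
  assumes "\<not> (\<exists>w. awalk x w y \<and> length w \<le> n)"
  shows "ereal (real n) \<le> graph_dist G x y"
  unfolding graph_dist_def \<mu>_def
proof (rule INF_greatest)
  fix w assume "w \<in> {w. awalk x w y}"
  then have "n \<le> length w" using assms by (metis mem_Collect_eq nat_le_linear)
  moreover have "awalk_cost (\<lambda>_. 1) w = real (length w)" by (induction w) auto
  ultimately show "ereal (real n) \<le> ereal (awalk_cost (\<lambda>_. 1) w)" by simp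
qed

end

theorem corollary1p4:
  fixes G :: "('a, 'b) pre_digraph" and p :: real
  assumes "simple_graph G"
    and "infinite (verts G)"
    and "Digraph_Component.connected G"
    and "locally_finite G"
    and "p_c_site G < ereal p"
    and "ereal p < p_conn G"
  shows "AE \<omega> in site_percolation G p. infinite (infinite_open_clusters G \<omega>)"
proof -
  interpret simple_graph G by fact
  interpret site_graph "verts G" "arcs_ends G"
  proof
    show "countable (verts G)" using assms(3,4) by (rule countable_verts)
    show "arcs_ends G \<subseteq> verts G \<times> verts G" using adj_in_verts by auto
    show "sym (arcs_ends G)" by (rule sym_arcs_ends)
    show "finite (arcs_ends G `` {v})" for v
      using assms(4) by (rule finite_nbrs_if_locally_finite)
  qed
  have law_eq: "site_percolation G q = law q" for q
    by (simp add: site_percolation_def law_def)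
  have clusters_eq: "infinite_open_clusters G \<omega> =
      {C. infinite C \<and> (\<exists>x\<in>opens \<omega>. C = cluster (arcs_ends G) (opens \<omega>) x)}" for \<omega>
    unfolding infinite_open_clusters_def open_clusters_conv opens_def by blast
  have conn_eq: "connection_prob G q x y = ennreal (Pr q (\<lambda>S. y \<in> cluster (arcs_ends G) S x))" for q x y
    unfolding connection_prob_def law_eq same_open_cluster_conv Pr_def opens_def
    by (simp add: law.emeasure_eq_measure)

  obtain p0 where p0: "p0 \<in> {0..1}" "p0 < p"
    "emeasure (law p0) {\<omega> \<in> space (law p0). infinite_open_clusters G \<omega> \<noteq> {}} = 1"
    using assms(5) unfolding p_c_site_def Inf_less_iff law_eq by auto
  obtain p1 where p1: "0 < p1" "p1 < 1" "p < p1"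
    "(\<lambda>n. SUP (x, y) \<in> {(x, y). x \<in> verts G \<and> y \<in> verts G \<and> ereal (real n) \<le> graph_dist G x y}.
        connection_prob G p1 x y) \<longlonglongrightarrow> 0"
    using assms(6) unfolding p_conn_def less_Sup_iff by auto
  have p: "p \<in> {0..1}" using p0 p1 by auto

  have "AE \<omega> in law p0. infinite_open_clusters G \<omega> \<noteq> {}"
  proof -
    have "{\<omega> \<in> space (law p0). infinite_open_clusters G \<omega> \<noteq> {}} \<in> sets (law p0)"
      using p0(3) emeasure_notin_sets by fastforce
    then show ?thesis
      using law.prob_Collect_eq_1[of p0] p0(3) by (simp add: law.emeasure_eq_measure)
  qed
  then have inf: "AE \<omega> in law p0. \<exists>x\<in>verts G. infinite (cluster (arcs_ends G) (opens \<omega>) x)"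
  proof eventually_elim
    case (elim \<omega>)
    then show ?case unfolding clusters_eq using opens_subset by blast
  qed

  \<comment> \<open>The bound at \<open>p1\<close> holds for all pairs at distance at least \<open>n\<close>, and balls are finite; monotonicity in the
    parameter transfers it to \<open>p\<close>.\<close>
  have decay: "\<exists>F. finite F \<and> (\<forall>y\<in>verts G - F. Pr p (\<lambda>S. y \<in> cluster (arcs_ends G) S x) \<le> \<epsilon>)"
    if x: "x \<in> verts G" and \<epsilon>: "0 < \<epsilon>" for x \<epsilon>
  proof -
    let ?far = "\<lambda>n. {(x, y). x \<in> verts G \<and> y \<in> verts G \<and> ereal (real n) \<le> graph_dist G x y}"
    have "\<forall>\<^sub>F n in sequentially. (SUP (x, y) \<in> ?far n. connection_prob G p1 x y) < ennreal \<epsilon>"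
      using p1(4) by (rule order_tendstoD(2)) (use \<epsilon> in simp)
    then obtain n where n: "(SUP (x, y) \<in> ?far n. connection_prob G p1 x y) < ennreal \<epsilon>"
      by (auto simp: eventually_sequentially)
    let ?F = "{y. \<exists>w. awalk x w y \<and> length w \<le> n}"
    have "Pr p (\<lambda>S. y \<in> cluster (arcs_ends G) S x) \<le> \<epsilon>" if y: "y \<in> verts G - ?F" for y
    proof -
      have "(x, y) \<in> ?far n" using x y graph_dist_ge by blast
      then have "connection_prob G p1 x y \<le> (SUP (x, y) \<in> ?far n. connection_prob G p1 x y)"
        by (rule SUP_upper2) simp
      with n have "ennreal (Pr p1 (\<lambda>S. y \<in> cluster (arcs_ends G) S x)) \<le> ennreal \<epsilon>"
        unfolding conn_eq[symmetric] by (meson le_less_trans less_imp_le)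
      then have "Pr p1 (\<lambda>S. y \<in> cluster (arcs_ends G) S x) \<le> \<epsilon>"
        using \<epsilon> by (simp add: ennreal_le_iff)
      moreover have "finitary (\<lambda>S. y \<in> cluster (arcs_ends G) S x)"
        using finitary_cluster[of y "{}" "{}" x] by simp
      then have "Pr p (\<lambda>S. y \<in> cluster (arcs_ends G) S x) \<le> Pr p1 (\<lambda>S. y \<in> cluster (arcs_ends G) S x)"
        by (rule Pr_mono_param) (use p p1 in auto)
      ultimately show ?thesis by linarith
    qed
    then show ?thesis using finite_walk_ball[OF assms(4)] by blast
  qed

  have "AE \<omega> in law p. spread (opens \<omega>)"
  proof (rule spread_almost_surely[OF p])
    show "0 < (p - p0) / 2" using p0 by simp
    show "\<exists>v\<in>verts G - F. (p - p0) / 2 < \<theta> p v" if "finite F" for F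
      by (rule supercritical_\<theta>_far_away[OF _ _ _ _ inf that]) (use p p0 in auto)
  qed (rule decay)
  then show ?thesis
    unfolding law_eq clusters_eq
    by eventually_elim (rule spread_infinitely_many[OF opens_subset])
qed

end
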